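(* Let $p \ne 3$ be a prime and let $r_1, r_2, r_3$ be non-negative integers with $r_3 > 0$. Then \[ V(r_3, r_2, r_1; p) \le V\big(r_3 - 1,\; r_2 + 6(r_3 - 1),\; r_1 + 6 r_2 + 9 r_3;\; p\big). \]
   Context: For non-negative integers $a,b,c$ and a prime $p$, $V(a,b,c;p)$ denotes the least integer $V$ such that every system consisting of $a$ cubic forms, $b$ quadratic forms and $c$ linear forms, all with coefficients in $\mathbb{Q}_p$ and in the same $n$ variables, has a common non-trivial zero $\mathbf{x}\in\mathbb{Q}_p^n\setminus\{\mathbf{0}\}$ whenever $n > V$. (In particular $V(0,0,c;p)=c$.) *)

theory Defs
  imports
    "HOL-Library.Extended_Nat"
    "HOL-Computational_Algebra.Fraction_Field"
    "Berlekamp_Zassenhaus.Finite_Field"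
begin

text \<open>
  The prime \<open>p\<close> is represented by a type \<open>'p\<close> with \<open>p = CARD('p)\<close> elements.  The ring of \<open>p\<close>-adic
  integers is the inverse limit of the rings \<open>\<int>/p\<^sup>n\<close>: an element is a compatible sequence of
  residues, the \<open>n\<close>-th one being given by its representative in \<open>{0..<p\<^sup>n}\<close>.
  The field \<open>\<rat>\<^sub>p\<close> is its fraction field \<open>'p padic\<close>.
\<close>

typedef 'p padic_int =
  "{f :: nat \<Rightarrow> int. \<forall>n. f n = f (Suc n) mod int (CARD('p :: prime_card)) ^ n}"
  morphisms padic_residue Abs_padic_int
  by (rule exI[of _ "\<lambda>_. 0"]) simp

setup_lifting type_definition_padic_int

lemma padic_compat_op1:
  fixes h :: "int \<Rightarrow> int" and m :: int
  assumes h: "\<And>k a. h (a mod k) mod k = h a mod k"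
    and f: "\<And>n. f n = f (Suc n) mod m ^ n"
  shows "h (f n) mod m ^ n = (h (f (Suc n)) mod m ^ Suc n) mod m ^ n"
proof -
  have "h (f n) mod m ^ n = h (f (Suc n) mod m ^ n) mod m ^ n"
    by (subst f) (rule refl)
  also have "\<dots> = h (f (Suc n)) mod m ^ n" by (rule h)
  finally show ?thesis by (simp add: mod_mod_cancel)
qed

lemma padic_compat_op2:
  fixes h :: "int \<Rightarrow> int \<Rightarrow> int" and m :: int
  assumes h: "\<And>k a b. h (a mod k) (b mod k) mod k = h a b mod k"
    and f: "\<And>n. f n = f (Suc n) mod m ^ n" and g: "\<And>n. g n = g (Suc n) mod m ^ n"
  shows "h (f n) (g n) mod m ^ n = (h (f (Suc n)) (g (Suc n)) mod m ^ Suc n) mod m ^ n"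
proof -
  have "h (f n) (g n) mod m ^ n = h (f (Suc n) mod m ^ n) (g (Suc n) mod m ^ n) mod m ^ n"
    by (subst f, subst g) (rule refl)
  also have "\<dots> = h (f (Suc n)) (g (Suc n)) mod m ^ n" by (rule h)
  finally show ?thesis by (simp add: mod_mod_cancel)
qed

lemma padic_residue_Suc_mod:
  "padic_residue (x :: 'p :: prime_card padic_int) (Suc n) mod int CARD('p) ^ n = padic_residue x n"
proof -
  have "\<forall>n. padic_residue x n = padic_residue x (Suc n) mod int CARD('p) ^ n"
    using padic_residue[of x] by (rule CollectD)
  then show ?thesis by (rule allE) (erule sym)
qed

lemma padic_residue_mod:
  "padic_residue (x :: 'p :: prime_card padic_int) n mod int CARD('p) ^ n = padic_residue x n"
  by (metis padic_residue_Suc_mod mod_mod_trivial)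

lemma padic_residue_mod_le:
  assumes "m \<le> n"
  shows "padic_residue (x :: 'p :: prime_card padic_int) n mod int CARD('p) ^ m = padic_residue x m"
  using assms
proof (induction n rule: dec_induct)
  case base
  show ?case by (rule padic_residue_mod)
next
  case (step n)
  have "padic_residue x (Suc n) mod int CARD('p) ^ m
      = (padic_residue x (Suc n) mod int CARD('p) ^ n) mod int CARD('p) ^ m"
    using step.hyps by (simp add: mod_mod_cancel le_imp_power_dvd)
  also have "padic_residue x (Suc n) mod int CARD('p) ^ n = padic_residue x n"
    by (rule padic_residue_Suc_mod)
  finally show ?case using step.IH by simp
qed

instantiation padic_int :: (prime_card) comm_ring_1
begin

lift_definition zero_padic_int :: "'a padic_int" is "\<lambda>_. 0" by simp

lift_definition one_padic_int :: "'a padic_int" is "\<lambda>n. 1 mod int CARD('a) ^ n"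
  by (simp add: mod_mod_cancel)

lift_definition plus_padic_int :: "'a padic_int \<Rightarrow> 'a padic_int \<Rightarrow> 'a padic_int"
  is "\<lambda>f g n. (f n + g n) mod int CARD('a) ^ n"
  by (rule padic_compat_op2[of "\<lambda>a b. a + b", OF mod_add_eq])

lift_definition minus_padic_int :: "'a padic_int \<Rightarrow> 'a padic_int \<Rightarrow> 'a padic_int"
  is "\<lambda>f g n. (f n - g n) mod int CARD('a) ^ n"
  by (rule padic_compat_op2[of "\<lambda>a b. a - b", OF mod_diff_eq])

lift_definition uminus_padic_int :: "'a padic_int \<Rightarrow> 'a padic_int"
  is "\<lambda>f n. (- f n) mod int CARD('a) ^ n"
  by (rule padic_compat_op1[of uminus, OF mod_minus_eq])

lift_definition times_padic_int :: "'a padic_int \<Rightarrow> 'a padic_int \<Rightarrow> 'a padic_int"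
  is "\<lambda>f g n. (f n * g n) mod int CARD('a) ^ n"
  by (rule padic_compat_op2[of "\<lambda>a b. a * b", OF mod_mult_eq])

instance
proof
  note padic_int_simps = padic_residue_inject[symmetric] fun_eq_iff zero_padic_int.rep_eq
    one_padic_int.rep_eq plus_padic_int.rep_eq minus_padic_int.rep_eq uminus_padic_int.rep_eq
    times_padic_int.rep_eq
  fix a b c :: "'a padic_int"
  show "a * b * c = a * (b * c)"
    by (simp add: padic_int_simps mod_simps mult_ac)
  show "a * b = b * a"
    by (simp add: padic_int_simps mult_ac)
  show "1 * a = a"
    by (simp add: padic_int_simps mod_simps padic_residue_mod)
  show "a + b + c = a + (b + c)"
    by (simp add: padic_int_simps mod_simps add_ac)
  show "a + b = b + a"
    by (simp add: padic_int_simps add_ac)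
  show "0 + a = a"
    by (simp add: padic_int_simps padic_residue_mod)
  show "- a + a = 0"
    by (simp add: padic_int_simps mod_simps)
  show "a - b = a + - b"
    by (simp add: padic_int_simps mod_simps)
  show "(a + b) * c = a * c + b * c"
    by (simp add: padic_int_simps mod_simps distrib_right)
  show "(0 :: 'a padic_int) \<noteq> 1"
  proof
    assume "(0 :: 'a padic_int) = 1"
    then have "padic_residue (0 :: 'a padic_int) 1 = padic_residue 1 1" by simp
    moreover have "1 < int CARD('a)" by (rule prime_gt_1_int[OF prime_card_int])
    ultimately show False by (simp add: zero_padic_int.rep_eq one_padic_int.rep_eq)
  qed
qed

end

instance padic_int :: (prime_card) idom
proof
  fix a b :: "'a padic_int"
  define p where "p = int CARD('a)"
  have p: "prime p" unfolding p_def by (rule prime_card_int)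
  assume "a \<noteq> 0" and "b \<noteq> 0"
  then obtain m k where m: "padic_residue a m \<noteq> 0" and k: "padic_residue b k \<noteq> 0"
    unfolding padic_residue_inject[symmetric] zero_padic_int.rep_eq fun_eq_iff by blast
  have "\<not> p ^ m dvd padic_residue a (m + k)" "\<not> p ^ k dvd padic_residue b (m + k)"
    using m k padic_residue_mod_le[of m "m + k" a] padic_residue_mod_le[of k "m + k" b]
    by (simp_all add: dvd_eq_mod_eq_0 p_def)
  then have "\<not> p ^ (m + k) dvd padic_residue a (m + k) * padic_residue b (m + k)"
    using prime_elem_power_dvd_cases[of p "m + k" _ _ m "Suc k"] power_le_dvd[of p "Suc k" _ k]
      prime_imp_prime_elem[OF p] by (metis add_Suc_right le_SucI order_refl)
  then have "padic_residue (a * b) (m + k) \<noteq> 0"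
    by (simp add: times_padic_int.rep_eq dvd_eq_mod_eq_0 p_def)
  then show "a * b \<noteq> 0"
    by (auto simp: zero_padic_int.rep_eq)
qed

type_synonym 'p padic = "'p padic_int fract"

text \<open>
  Forms in \<open>n\<close> variables \<open>x 0, \<dots>, x (n - 1)\<close>.  The coefficient arrays need not be symmetric, so that
  every homogeneous polynomial of the given degree (including 0) arises.
\<close>

definition linear_form :: "nat \<Rightarrow> (nat \<Rightarrow> 'k) \<Rightarrow> (nat \<Rightarrow> 'k) \<Rightarrow> 'k :: comm_ring_1" where
  "linear_form n c x = (\<Sum>i<n. c i * x i)"

definition quadratic_form :: "nat \<Rightarrow> (nat \<Rightarrow> nat \<Rightarrow> 'k) \<Rightarrow> (nat \<Rightarrow> 'k) \<Rightarrow> 'k :: comm_ring_1" where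
  "quadratic_form n c x = (\<Sum>i<n. \<Sum>j<n. c i j * x i * x j)"

definition cubic_form ::
  "nat \<Rightarrow> (nat \<Rightarrow> nat \<Rightarrow> nat \<Rightarrow> 'k) \<Rightarrow> (nat \<Rightarrow> 'k) \<Rightarrow> 'k :: comm_ring_1" where
  "cubic_form n c x = (\<Sum>i<n. \<Sum>j<n. \<Sum>k<n. c i j k * x i * x j * x k)"

definition all_systems_solvable ::
  "'k :: field itself \<Rightarrow> nat \<Rightarrow> nat \<Rightarrow> nat \<Rightarrow> nat \<Rightarrow> bool" where
  "all_systems_solvable (_ :: 'k itself) a b c n \<longleftrightarrow>
    (\<forall>(C :: nat \<Rightarrow> nat \<Rightarrow> nat \<Rightarrow> nat \<Rightarrow> 'k) (Q :: nat \<Rightarrow> nat \<Rightarrow> nat \<Rightarrow> 'k) (L :: nat \<Rightarrow> nat \<Rightarrow> 'k).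
      \<exists>x :: nat \<Rightarrow> 'k. (\<exists>i<n. x i \<noteq> 0) \<and>
        (\<forall>l<a. cubic_form n (C l) x = 0) \<and>
        (\<forall>l<b. quadratic_form n (Q l) x = 0) \<and>
        (\<forall>l<c. linear_form n (L l) x = 0))"

text \<open>
  \<open>V(a,b,c;p)\<close> with \<open>p = CARD('p)\<close>.  Being an infimum in \<^typ>\<open>enat\<close>, it is the least
  admissible \<open>v\<close> if there is one, and \<open>\<infinity>\<close> otherwise.  Negative \<open>v\<close> are never admissible,
  since there is no non-trivial zero in \<open>0\<close> variables.
\<close>

definition V :: "'p :: prime_card itself \<Rightarrow> nat \<Rightarrow> nat \<Rightarrow> nat \<Rightarrow> enat" where
  "V (_ :: 'p itself) a b c =
    Inf {enat v |v. \<forall>n>v. all_systems_solvable TYPE('p padic) a b c n}"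

end

theory Submission
  imports
    "HOL-Algebra.Algebraic_Closure_Type"
    Defs
begin

text \<open>
  Given a system with \<open>r\<^sub>3\<close> cubic forms, collect vectors at which all forms but the first cubic
  form \<open>C\<close> vanish.  Requiring that certain polar forms vanish at a new vector keeps these zeros
  compatible with each other; this costs \<open>6 (r\<^sub>3 - 1)\<close> quadratic and \<open>6 r\<^sub>2 + 9 r\<^sub>3\<close> linear conditions
  when six vectors are already there, two for each class of the valuation of \<open>C\<close> modulo \<open>3\<close>.  The
  seventh vector makes three of one class.  On their span all other forms vanish, and \<open>C\<close> becomes,
  up to a scalar, \<open>a t\<^sup>3 + \<beta> t u\<^sup>2 + b u\<^sup>3 + s\<^sup>2 (l t + m u) + c s\<^sup>3\<close> with units \<open>a, b, c\<close>.

  Such a form has a non-trivial \<open>p\<close>-adic zero if \<open>p \<noteq> 3\<close>: a depressed cubic polynomial with non-zero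
  constant term has no triple root modulo \<open>p\<close>, so by Hensel's lemma a zero modulo \<open>p\<close> is enough, and
  a non-integral \<open>\<beta>\<close>, \<open>l\<close> or \<open>m\<close> produces a zero directly.

  The zero modulo \<open>p\<close> is a point of a plane cubic without rational points at infinity.  It is found
  by comparing, for given trace and norm, the number of elements of the field with \<open>p\<^sup>3\<close> elements
  and of the algebra of triples over the field with \<open>p\<close> elements; this replaces Hasse's bound for
  curves of genus one.
\<close>

section \<open>Traces and norms in a cubic extension of a prime field\<close>

definition frob :: "'a :: field_prime_char \<Rightarrow> 'a" where
  "frob x = x ^ CHAR('a)"

lemma frob_0 [simp]: "frob 0 = 0"
  by (simp add: frob_def)

lemma frob_1 [simp]: "frob 1 = 1"
  by (simp add: frob_def)

lemma frob_add: "frob (x + y) = frob x + frob y"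
  by (simp add: frob_def freshmans_dream)

lemma frob_mult: "frob (x * y) = frob x * frob y"
  by (simp add: frob_def power_mult_distrib)

lemma frob_uminus: "frob (- x) = - frob x"
  by (metis add_eq_0_iff frob_0 frob_add)

lemma frob_diff: "frob (x - y) = frob x - frob y"
  by (metis add_uminus_conv_diff frob_add frob_uminus)

lemma frob_power: "frob (x ^ n) = frob x ^ n"
  by (simp add: frob_def mult.commute flip: power_mult)

lemma frob_divide: "frob (x / y) = frob x / frob y"
  by (simp add: frob_def power_divide)

lemma frob_eq_0_iff [simp]: "frob x = 0 \<longleftrightarrow> x = 0"
  by (simp add: frob_def)

lemma frob_eq_iff [simp]: "frob x = frob y \<longleftrightarrow> x = y"
  by (metis eq_iff_diff_eq_0 frob_diff frob_eq_0_iff)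

lemma frob_of_nat [simp]: "frob (of_nat n) = of_nat n"
  by (induction n) (auto simp: frob_add)

lemma frob_of_int [simp]: "frob (of_int n) = of_int n"
  by (cases n rule: int_cases2) (auto simp: frob_uminus)

lemmas frob_simps = frob_add frob_mult frob_uminus frob_diff frob_power frob_divide

definition Fp :: "'a :: field_prime_char set" where
  "Fp = {x. frob x = x}"

lemma Fp_closed [simp, intro]:
  "0 \<in> Fp" "1 \<in> Fp"
  "x \<in> Fp \<Longrightarrow> y \<in> Fp \<Longrightarrow> x + y \<in> Fp"
  "x \<in> Fp \<Longrightarrow> y \<in> Fp \<Longrightarrow> x - y \<in> Fp"
  "x \<in> Fp \<Longrightarrow> y \<in> Fp \<Longrightarrow> x * y \<in> Fp"
  "x \<in> Fp \<Longrightarrow> y \<in> Fp \<Longrightarrow> x / y \<in> Fp"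
  "x \<in> Fp \<Longrightarrow> - x \<in> Fp"
  "x \<in> Fp \<Longrightarrow> x ^ k \<in> Fp"
  by (simp_all add: Fp_def frob_simps)

lemma frob_eq_of_Fp: "x \<in> Fp \<Longrightarrow> frob x = x"
  by (simp add: Fp_def)

text \<open>\<open>X ^ p - X\<close> has at most \<open>p\<close> roots, and the images of
  \<open>0, ..., p - 1\<close> are \<open>p\<close> distinct ones.\<close>

lemma Fp_eq: "(Fp :: 'a set) = of_nat ` {..<CHAR('a :: field_prime_char)}"
  and finite_Fp [simp]: "finite (Fp :: 'a set)"
  and card_Fp: "card (Fp :: 'a set) = CHAR('a)"
proof -
  let ?q = "CHAR('a)"
  let ?P = "monom 1 ?q - monom 1 1 :: 'a poly"
  have q: "1 < ?q" by (rule prime_gt_1_nat) simp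
  have "coeff ?P ?q \<noteq> 0" using q by simp
  then have P0: "?P \<noteq> 0" by (metis coeff_0)
  have deg: "degree ?P \<le> ?q"
    by (rule degree_diff_le) (use q in \<open>auto simp: degree_monom_eq\<close>)
  have Fp_roots: "(Fp :: 'a set) = {x. poly ?P x = 0}"
    by (auto simp: Fp_def frob_def poly_monom)
  have fin: "finite (Fp :: 'a set)"
    unfolding Fp_roots using P0 by (rule poly_roots_finite)
  have le: "card (Fp :: 'a set) \<le> ?q"
    unfolding Fp_roots by (rule order_trans[OF card_poly_roots_bound[OF P0] deg])
  have sub: "of_nat ` {..<?q} \<subseteq> (Fp :: 'a set)"
    by (auto simp: Fp_def)
  have inj: "inj_on (of_nat :: nat \<Rightarrow> 'a) {..<?q}"
  proof (rule linorder_inj_onI)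
    fix i j :: nat
    assume "i < j" "i \<in> {..<?q}" "j \<in> {..<?q}"
    then have "\<not> ?q dvd j - i" by (auto dest: dvd_imp_le)
    then have "(of_nat (j - i) :: 'a) \<noteq> 0" by (simp add: of_nat_eq_0_iff_char_dvd)
    then show "(of_nat i :: 'a) \<noteq> of_nat j" using \<open>i < j\<close> by (simp add: of_nat_diff)
  qed auto
  have "card (of_nat ` {..<?q} :: 'a set) = ?q"
    using card_image[OF inj] by simp
  then show eq: "(Fp :: 'a set) = of_nat ` {..<?q}"
    using card_subset_eq[OF fin sub] card_mono[OF fin sub] le by (metis le_antisym)
  show "finite (Fp :: 'a set)" by (fact fin)
  show "card (Fp :: 'a set) = ?q"
    using card_image[OF inj] eq by simp
qed

section \<open>Vieta's formulas and the roots of irreducible cubics\<close>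

lemma cubic_divided_difference:
  fixes x y :: "'a :: field"
  assumes "x ^ 3 + a * x ^ 2 + b * x + c = 0" "y ^ 3 + a * y ^ 2 + b * y + c = 0" "x \<noteq> y"
  shows "x ^ 2 + x * y + y ^ 2 + a * (x + y) + b = 0"
proof -
  have "(x - y) * (x ^ 2 + x * y + y ^ 2 + a * (x + y) + b)
      = (x ^ 3 + a * x ^ 2 + b * x + c) - (y ^ 3 + a * y ^ 2 + b * y + c)"
    by (simp add: algebra_simps power2_eq_square power3_eq_cube)
  then show ?thesis using assms by simp
qed

text \<open>The first divided differences are free of \<open>c\<close>, the second one also of
  \<open>b\<close>; it yields the sum of the roots, and the other two formulas follow by
  substituting back.\<close>

lemma cubic_vieta:
  fixes x y z :: "'a :: field"
  assumes "x ^ 3 + a * x ^ 2 + b * x + c = 0" "y ^ 3 + a * y ^ 2 + b * y + c = 0"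
    "z ^ 3 + a * z ^ 2 + b * z + c = 0" and ne: "x \<noteq> y" "y \<noteq> z" "x \<noteq> z"
  shows "x + y + z = - a" "x * y + x * z + y * z = b" "x * y * z = - c"
proof -
  note 1 = cubic_divided_difference[OF assms(1,2) ne(1)]
  note 2 = cubic_divided_difference[OF assms(2,3) ne(2)]
  have "(x - z) * (x + y + z + a) = (x ^ 2 + x * y + y ^ 2 + a * (x + y) + b)
      - (y ^ 2 + y * z + z ^ 2 + a * (y + z) + b)"
    by (simp add: algebra_simps power2_eq_square)
  then have "x + y + z + a = 0" using ne 1 2 by simp
  then have a: "a = - (x + y + z)" by (metis add.commute add_eq_0_iff)
  then show "x + y + z = - a" by simp
  have "x * y + x * z + y * z - b = - (x ^ 2 + x * y + y ^ 2 + a * (x + y) + b)"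
    unfolding a by (simp add: algebra_simps power2_eq_square)
  then show b: "x * y + x * z + y * z = b" using 1 by simp
  have "x * y * z - (- c) = x ^ 3 + a * x ^ 2 + b * x + c"
    unfolding a b[symmetric] by (simp add: algebra_simps power2_eq_square power3_eq_cube)
  then show "x * y * z = - c" using assms(1) by (metis eq_iff_diff_eq_0)
qed

text \<open>Frobenius permutes the roots of a polynomial over \<open>Fp\<close>. The orbit of
  \<open>x\<close> is not a single point, and an orbit of length two would leave a third root in
  \<open>Fp\<close>; so the three conjugates are all the roots.\<close>

lemma irreducible_cubic_root:
  fixes x :: "'a :: field_prime_char"
  assumes coeffs: "a \<in> Fp" "b \<in> Fp" "c \<in> Fp"
    and no_root: "\<forall>r\<in>Fp. r ^ 3 + a * r ^ 2 + b * r + c \<noteq> 0"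
    and x: "x ^ 3 + a * x ^ 2 + b * x + c = 0"
  shows "x \<noteq> frob x" "frob x \<noteq> frob (frob x)" "x \<noteq> frob (frob x)"
    "frob (frob (frob x)) = x"
    "x + frob x + frob (frob x) = - a"
    "x * frob x + x * frob (frob x) + frob x * frob (frob x) = b"
    "x * frob x * frob (frob x) = - c"
proof -
  define y where "y = frob x"
  define z where "z = frob y"
  have root_frob: "frob u ^ 3 + a * frob u ^ 2 + b * frob u + c = 0"
    if "u ^ 3 + a * u ^ 2 + b * u + c = 0" for u
  proof -
    have "frob (u ^ 3 + a * u ^ 2 + b * u + c) = frob 0" using that by simp
    then show ?thesis using coeffs by (simp only: frob_simps frob_eq_of_Fp frob_0)
  qed
  have y: "y ^ 3 + a * y ^ 2 + b * y + c = 0"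
    unfolding y_def by (rule root_frob[OF x])
  have z: "z ^ 3 + a * z ^ 2 + b * z + c = 0"
    unfolding z_def by (rule root_frob[OF y])
  have xy: "x \<noteq> y" using no_root x by (auto simp: y_def Fp_def)
  then have yz: "y \<noteq> z" by (simp add: y_def z_def)
  have xz: "x \<noteq> z"
  proof
    assume "x = z"
    \<comment> \<open>The remaining root, found from the sum of the roots; it is in
      \<open>Fp\<close> because Frobenius would only swap \<open>x\<close> and
      \<open>y\<close>.\<close>
    define r where "r = - a - x - y"
    have "r \<in> Fp"
      using coeffs \<open>x = z\<close>
      unfolding Fp_def r_def y_def z_def by (simp add: frob_diff frob_uminus)
    have "r ^ 3 + a * r ^ 2 + b * r + c = (x ^ 3 + a * x ^ 2 + b * x + c)
        + (r - x) * (x ^ 2 + x * r + r ^ 2 + a * (x + r) + b)"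
      by (simp add: algebra_simps power2_eq_square power3_eq_cube)
    also have "x ^ 2 + x * r + r ^ 2 + a * (x + r) + b = x ^ 2 + x * y + y ^ 2 + a * (x + y) + b"
      unfolding r_def by (simp add: algebra_simps power2_eq_square)
    finally have "r ^ 3 + a * r ^ 2 + b * r + c = 0"
      using x cubic_divided_difference[OF x y xy] by simp
    with no_root \<open>r \<in> Fp\<close> show False by blast
  qed
  note v = cubic_vieta[OF x y z xy yz xz]
  \<comment> \<open>The sum of the roots is fixed by Frobenius, so \<open>frob z\<close> must be
    \<open>x\<close>.\<close>
  have "frob (x + y + z) = frob (- a)" using v(1) by simp
  then have "y + z + frob z = - a"
    using coeffs by (simp add: frob_simps frob_eq_of_Fp y_def z_def)
  then have "x + (y + z) = frob z + (y + z)" using v(1) by (simp add: algebra_simps)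
  then have fz: "frob z = x" by simp
  show "x \<noteq> frob x" "frob x \<noteq> frob (frob x)" "x \<noteq> frob (frob x)"
    "frob (frob (frob x)) = x"
    "x + frob x + frob (frob x) = - a"
    "x * frob x + x * frob (frob x) + frob x * frob (frob x) = b"
    "x * frob x * frob (frob x) = - c"
    using xy yz xz fz v unfolding y_def z_def by auto
qed

text \<open>
  \<open>Fp\<close> and \<open>Fp3\<close> are the subfields with \<open>p\<close> and \<open>p\<^sup>3\<close> elements if the ambient field is algebraically
  closed; \<open>tr3\<close>, \<open>pr3\<close>, \<open>nm3\<close> are the elementary symmetric functions of the three conjugates.
\<close>

definition Fp3 :: "'a :: field_prime_char set" where
  "Fp3 = {x. frob (frob (frob x)) = x}"

definition tr3 :: "'a :: field_prime_char \<Rightarrow> 'a" where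
  "tr3 x = x + frob x + frob (frob x)"

definition nm3 :: "'a :: field_prime_char \<Rightarrow> 'a" where
  "nm3 x = x * frob x * frob (frob x)"

definition pr3 :: "'a :: field_prime_char \<Rightarrow> 'a" where
  "pr3 x = x * frob x + x * frob (frob x) + frob x * frob (frob x)"

lemma Fp_subset_Fp3: "x \<in> Fp \<Longrightarrow> x \<in> Fp3"
  by (simp add: Fp_def Fp3_def)

lemma Fp3_frob: "x \<in> Fp3 \<Longrightarrow> frob x \<in> Fp3"
  by (simp add: Fp3_def)

lemma Fp3_closed:
  "x \<in> Fp3 \<Longrightarrow> y \<in> Fp3 \<Longrightarrow> x + y \<in> Fp3"
  "x \<in> Fp3 \<Longrightarrow> y \<in> Fp3 \<Longrightarrow> x - y \<in> Fp3"
  "x \<in> Fp3 \<Longrightarrow> y \<in> Fp3 \<Longrightarrow> x * y \<in> Fp3"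
  "x \<in> Fp3 \<Longrightarrow> y \<in> Fp3 \<Longrightarrow> x / y \<in> Fp3"
  "x \<in> Fp3 \<Longrightarrow> x ^ k \<in> Fp3"
  by (simp_all add: Fp3_def frob_simps)

lemma finite_Fp3 [simp]: "finite (Fp3 :: 'a :: field_prime_char set)"
proof -
  let ?q = "CHAR('a)"
  let ?Q = "?q * ?q * ?q"
  let ?P = "monom 1 ?Q - monom 1 1 :: 'a poly"
  have "1 < ?q" by (rule prime_gt_1_nat) simp
  then have q: "1 < ?Q" by (metis less_1_mult)
  have "coeff ?P ?Q \<noteq> 0" using q by simp
  then have P0: "?P \<noteq> 0" by (metis coeff_0)
  have "(Fp3 :: 'a set) = {x. poly ?P x = 0}"
    by (auto simp: Fp3_def frob_def poly_monom simp flip: power_mult)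
  then show ?thesis using poly_roots_finite[OF P0] by simp
qed

lemma sym3_in_Fp:
  assumes "x \<in> Fp3"
  shows "tr3 x \<in> Fp" "nm3 x \<in> Fp" "pr3 x \<in> Fp"
  using assms by (simp_all add: Fp3_def Fp_def tr3_def nm3_def pr3_def frob_simps algebra_simps)

lemma sym3_frob:
  assumes "x \<in> Fp3"
  shows "tr3 (frob x) = tr3 x" "nm3 (frob x) = nm3 x" "pr3 (frob x) = pr3 x"
  using assms by (simp_all add: Fp3_def tr3_def nm3_def pr3_def algebra_simps)

lemma nm3_mult: "nm3 (x * y) = nm3 x * nm3 y"
  by (simp add: nm3_def frob_simps)

lemma nm3_eq_0_iff [simp]: "nm3 x = 0 \<longleftrightarrow> x = 0"
  by (simp add: nm3_def)

section \<open>Counting elements with given trace and norm\<close>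

lemma card_fibres:
  assumes "finite S" "finite T" "g ` S \<subseteq> T"
  shows "card S = (\<Sum>y\<in>T. card {x \<in> S. g x = y})"
  using sum.group[OF assms, of "\<lambda>_. 1 :: nat"] by simp

lemma sum_prod_eq:
  fixes y z :: "'a :: field"
  assumes "y' + z' = y + z" "y' * z' = y * z"
  shows "(y' = y \<and> z' = z) \<or> (y' = z \<and> z' = y)"
proof -
  have z': "z' = y + z - y'" using assms(1) by (simp add: algebra_simps)
  have "(y' - y) * (y' - z) = y * z - y' * z'"
    unfolding z' by (simp add: algebra_simps)
  then show ?thesis using assms z' by auto
qed

definition root_triples :: "'a :: field_prime_char \<Rightarrow> 'a \<Rightarrow> 'a \<Rightarrow> ('a \<times> 'a \<times> 'a) set" where
  "root_triples t e n =
    {(x, y, z) \<in> Fp \<times> Fp \<times> Fp. x + y + z = t \<and> x * y + x * z + y * z = e \<and> x * y * z = n}"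

text \<open>\<open>x'\<close> is a root of \<open>(T - x) (T - y) (T - z)\<close>, hence one of
  \<open>x\<close>, \<open>y\<close>, \<open>z\<close>; sum and product then fix the other two
  entries up to order.\<close>

lemma root_triples_subset:
  assumes "(x, y, z) \<in> root_triples t e n"
  shows "root_triples t e n
    \<subseteq> {(x, y, z), (x, z, y), (y, x, z), (y, z, x), (z, x, y), (z, y, x)}"
proof (rule subsetI)
  fix w assume "w \<in> root_triples t e n"
  then obtain x' y' z' where w: "w = (x', y', z')" "(x', y', z') \<in> root_triples t e n"
    by (cases w) auto
  from assms have t: "t = x + y + z" and e: "e = x * y + x * z + y * z" and n: "n = x * y * z"
    by (auto simp: root_triples_def)
  from w have s: "x' + y' + z' = x + y + z" "x' * y' + x' * z' + y' * z' = x * y + x * z + y * z"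
    "x' * y' * z' = x * y * z"
    by (auto simp: root_triples_def t e n)
  have *: "(y' = b \<and> z' = c) \<or> (y' = c \<and> z' = b)"
    if "x' = a" "a + b + c = x + y + z" "a * b + a * c + b * c = x * y + x * z + y * z" for a b c
  proof (rule sum_prod_eq)
    have "x' + (y' + z') = a + (b + c)" using s that by (simp add: algebra_simps)
    then show 1: "y' + z' = b + c" using that by simp
    have "x' * (y' + z') + y' * z' = a * (b + c) + b * c"
      using s that by (simp add: algebra_simps)
    then show "y' * z' = b * c" using 1 that by simp
  qed
  have "(x' - x) * (x' - y) * (x' - z)
      = x' ^ 3 - (x + y + z) * x' ^ 2 + (x * y + x * z + y * z) * x' - x * y * z"
    by (simp add: algebra_simps power2_eq_square power3_eq_cube)
  also have "\<dots> = 0"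
    unfolding s[symmetric] by (simp add: algebra_simps power2_eq_square power3_eq_cube)
  finally consider "x' = x" | "x' = y" | "x' = z" by auto
  then show "w \<in> {(x, y, z), (x, z, y), (y, x, z), (y, z, x), (z, x, y), (z, y, x)}"
  proof cases
    case 1
    show ?thesis using *[OF 1, of y z] 1 w by auto
  next
    case 2
    show ?thesis using *[OF 2, of x z] 2 w by (auto simp: algebra_simps)
  next
    case 3
    show ?thesis using *[OF 3, of x y] 3 w by (auto simp: algebra_simps)
  qed
qed

lemma finite_root_triples [simp]: "finite (root_triples t e n)"
  by (rule finite_subset[of _ "Fp \<times> Fp \<times> Fp"]) (auto simp: root_triples_def)

text \<open>
  If \<open>R\<close> is the number of roots in \<open>Fp\<close> of a cubic polynomial, then the polynomial has \<open>B\<close> ordered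
  triples of roots in \<open>Fp\<close> and is the characteristic polynomial of \<open>A = B - 3 R + 3\<close> elements of \<open>Fp3\<close>,
  whatever its splitting type.
\<close>

lemma card_root_triples_le:
  fixes t e n :: "'a :: {alg_closed_field, field_prime_char}"
  assumes coeffs: "t \<in> Fp" "e \<in> Fp" "n \<in> Fp"
  shows "card (root_triples t e n) + 3 \<le> card {v \<in> Fp3. tr3 v = t \<and> nm3 v = n \<and> pr3 v = e}
    + 3 * card {x \<in> Fp. x ^ 3 + (- t) * x ^ 2 + e * x + (- n) = 0}"
    (is "card ?B + 3 \<le> card ?A + 3 * card ?R")
proof (cases "?R = {}")
  case True
  \<comment> \<open>Without a root in \<open>Fp\<close> the cubic is irreducible: its three
    conjugate roots lie in \<open>?A\<close>, and there are no triples.\<close>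
  obtain x where "poly [:- n, e, - t, 1:] x = 0"
    using alg_closed_imp_poly_has_root[of "[:- n, e, - t, 1:]"] by auto
  then have x: "x ^ 3 + (- t) * x ^ 2 + e * x + (- n) = 0"
    by (simp add: algebra_simps power2_eq_square power3_eq_cube)
  have nr: "\<forall>r\<in>Fp. r ^ 3 + (- t) * r ^ 2 + e * r + (- n) \<noteq> 0"
    using True by blast
  have cf: "- t \<in> Fp" "e \<in> Fp" "- n \<in> Fp" using coeffs by auto
  note irr = irreducible_cubic_root[OF cf nr x]
  have xA: "x \<in> ?A"
    using irr by (simp add: Fp3_def tr3_def nm3_def pr3_def)
  have fA: "frob v \<in> ?A" if "v \<in> ?A" for v
    using that by (simp add: Fp3_frob sym3_frob)
  have "{x, frob x, frob (frob x)} \<subseteq> ?A" using xA fA by blast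
  then have "card {x, frob x, frob (frob x)} \<le> card ?A" by (intro card_mono) auto
  then have A: "3 \<le> card ?A" using irr by simp
  have "?B = {}"
  proof (rule ccontr)
    assume "?B \<noteq> {}"
    then obtain a b c where "(a, b, c) \<in> ?B" by auto
    then have "a \<in> ?R"
      by (auto simp: root_triples_def algebra_simps power2_eq_square power3_eq_cube)
    with True show False by blast
  qed
  then show ?thesis using A by simp
next
  case False
  show ?thesis
  proof (cases "?B = {}")
    case True
    have "0 < card ?R" using False by (auto simp: card_gt_0_iff)
    then show ?thesis using True by simp
  next
    case False
    then obtain x y z where xyz: "(x, y, z) \<in> ?B" by auto
    then have F: "x \<in> Fp" "y \<in> Fp" "z \<in> Fp"
      and s: "t = x + y + z" "e = x * y + x * z + y * z" "n = x * y * z"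
      by (auto simp: root_triples_def)
    have "u ^ 3 + (- t) * u ^ 2 + e * u + (- n) = (u - x) * (u - y) * (u - z)" for u
      unfolding s by (simp add: algebra_simps power2_eq_square power3_eq_cube)
    then have R: "?R = {x, y, z}" using F by auto
    let ?P = "{(x, y, z), (x, z, y), (y, x, z), (y, z, x), (z, x, y), (z, y, x)}"
    have B: "card ?B \<le> card ?P"
      by (rule card_mono) (use root_triples_subset[OF xyz] in auto)
    have A: "1 \<le> card ?A" if "x = y" "y = z"
    proof -
      have "x \<in> ?A" using F(1) that
        by (simp add: s Fp_subset_Fp3 tr3_def nm3_def pr3_def frob_eq_of_Fp)
      then have "?A \<noteq> {}" by blast
      moreover have "finite ?A" by simp
      ultimately have "0 < card ?A" by (rule card_gt_0_iff[THEN iffD2, OF conjI])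
      then show ?thesis by simp
    qed
    \<comment> \<open>For one, two or three distinct roots there are at most 1, 3 or 6 triples; only
      the first case needs an element of \<open>?A\<close>.\<close>
    consider "x = y" "y = z" | "x = y" "y \<noteq> z" | "x = z" "x \<noteq> y" | "y = z" "x \<noteq> y"
      | "x \<noteq> y" "x \<noteq> z" "y \<noteq> z" by blast
    then show ?thesis
      unfolding R using A B by cases (simp_all add: insert_commute card_insert_if)
  qed
qed

text \<open>
  Summing over the middle coefficient: every non-zero \<open>x\<close> is a root for exactly one value of it, so
  the values of \<open>R\<close> add up to \<open>p - 1\<close>.
\<close>

lemma card_trace_norm_ge:
  fixes t n :: "'a :: {alg_closed_field, field_prime_char}"
  assumes "t \<in> Fp" "n \<in> Fp" "n \<noteq> 0"
  shows "card {(x, y, z) \<in> Fp \<times> Fp \<times> Fp. x + y + z = t \<and> x * y * z = n} + 3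
    \<le> card {v \<in> Fp3. tr3 v = t \<and> nm3 v = n}" (is "card ?B + 3 \<le> card ?A")
proof -
  let ?q = "CHAR('a)"
  let ?R = "\<lambda>e. {x \<in> Fp. x ^ 3 + (- t) * x ^ 2 + e * x + (- n) = 0}"
  have A: "card ?A = (\<Sum>e\<in>Fp. card {v \<in> Fp3. tr3 v = t \<and> nm3 v = n \<and> pr3 v = e})"
    by (subst card_fibres[of _ Fp pr3]) (auto simp: sym3_in_Fp conj_assoc)
  have "card ?B = (\<Sum>e\<in>Fp. card {w \<in> ?B. (\<lambda>(x, y, z). x * y + x * z + y * z) w = e})"
    by (rule card_fibres) (auto intro: finite_subset[of _ "Fp \<times> Fp \<times> Fp"])
  also have "\<dots> = (\<Sum>e\<in>Fp. card (root_triples t e n))"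
    by (intro sum.cong refl arg_cong[where f = card]) (auto simp: root_triples_def)
  finally have B: "card ?B = (\<Sum>e\<in>Fp. card (root_triples t e n))" .
  have root_iff: "x ^ 3 + (- t) * x ^ 2 + e * x + (- n) = 0
      \<longleftrightarrow> x \<noteq> 0 \<and> (n - x ^ 3 + t * x ^ 2) / x = e" for x e
    using assms(3) by (cases "x = 0") (auto simp: field_simps eq_diff_eq)
  have "card (Fp - {0 :: 'a}) = (\<Sum>e\<in>Fp. card {x \<in> Fp - {0}. (n - x ^ 3 + t * x ^ 2) / x = e})"
    by (rule card_fibres) (use assms in auto)
  also have "\<dots> = (\<Sum>e\<in>Fp. card (?R e))"
    by (intro sum.cong refl arg_cong[where f = card]) (use root_iff in auto)
  finally have "(\<Sum>e\<in>Fp. card (?R e)) = card (Fp - {0 :: 'a})" ..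
  then have R: "(\<Sum>e\<in>Fp. card (?R e)) + 1 = ?q"
    by (simp add: card_Fp)
  have "(\<Sum>e\<in>Fp. card (root_triples t e n) + 3)
      \<le> (\<Sum>e\<in>Fp. card {v \<in> Fp3. tr3 v = t \<and> nm3 v = n \<and> pr3 v = e} + 3 * card (?R e))"
    by (intro sum_mono card_root_triples_le) (use assms in auto)
  \<comment> \<open>The constant 3 adds up to \<open>3 p\<close>, of which the roots use up
    \<open>3 (p - 1)\<close>; the gain of 3 remains.\<close>
  then have "card ?B + 3 * ?q \<le> card ?A + 3 * (\<Sum>e\<in>Fp. card (?R e))"
    unfolding A B by (simp add: sum.distrib card_Fp mult.commute flip: sum_distrib_left)
  then show ?thesis using R by linarith
qed

section \<open>Equations between trace and norm\<close>

lemma card_Fp_ne_0: "card (Fp - {0 :: 'a :: field_prime_char}) = CHAR('a) - 1"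
  by (simp add: card_Fp)

text \<open>A non-zero norm prescribes the trace, and comparison with triples gains 3 for each of
  the \<open>p - 1\<close> norms. There are at least \<open>(p - 1) ^ 2 - (2 p - 3)\<close> triples,
  which gives \<open>p ^ 2 - p + 1\<close> in total.\<close>

lemma card_trace_norm_line_ge:
  fixes k c :: "'a :: {alg_closed_field, field_prime_char}"
  assumes k: "k \<in> Fp" "k \<noteq> 0" and c: "c \<in> Fp" "c \<noteq> 0"
  shows "CHAR('a) ^ 2 + 1 \<le> card {v \<in> Fp3. tr3 v + k * nm3 v + c = 0} + CHAR('a)"
    (is "_ \<le> card ?T + _")
proof -
  let ?q = "CHAR('a)"
  let ?F = "Fp - {0 :: 'a}"
  let ?S = "{(x, y, z) \<in> ?F \<times> ?F \<times> ?F. x + y + z + k * (x * y * z) + c = 0}"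
  let ?A = "\<lambda>n. {v \<in> Fp3. tr3 v = - c - k * n \<and> nm3 v = n}"
  let ?B = "\<lambda>n. {(x, y, z) \<in> Fp \<times> Fp \<times> Fp. x + y + z = - c - k * n \<and> x * y * z = n}"
  have iff: "u + k * n + c = 0 \<longleftrightarrow> u = - c - k * n" for u n
    by (simp add: eq_diff_eq eq_neg_iff_add_eq_0 algebra_simps)
  have "?T \<subseteq> Fp3" by blast
  then have fin: "finite ?T" by (rule finite_subset) simp
  have "card {v \<in> ?T. v \<noteq> 0} = (\<Sum>n\<in>?F. card {v \<in> {v \<in> ?T. v \<noteq> 0}. nm3 v = n})"
    by (rule card_fibres) (auto simp: sym3_in_Fp)
  also have "\<dots> = (\<Sum>n\<in>?F. card (?A n))"
    by (intro sum.cong refl arg_cong[where f = card]) (auto simp: iff)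
  finally have T: "(\<Sum>n\<in>?F. card (?A n)) = card {v \<in> ?T. v \<noteq> 0}" ..
  have "card {v \<in> ?T. v \<noteq> 0} \<le> card ?T"
    by (rule card_mono[OF fin]) auto
  with T have T: "(\<Sum>n\<in>?F. card (?A n)) \<le> card ?T" by simp
  have "card ?S = (\<Sum>n\<in>?F. card {w \<in> ?S. (\<lambda>(x, y, z). x * y * z) w = n})"
    by (rule card_fibres) (auto intro: finite_subset[of _ "?F \<times> ?F \<times> ?F"])
  also have "\<dots> = (\<Sum>n\<in>?F. card (?B n))"
    by (intro sum.cong refl arg_cong[where f = card]) (auto simp: iff)
  finally have S: "card ?S = (\<Sum>n\<in>?F. card (?B n))" .
  have "(\<Sum>n\<in>?F. card (?B n) + 3) \<le> (\<Sum>n\<in>?F. card (?A n))"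
    by (intro sum_mono card_trace_norm_ge) (use k c in auto)
  then have ST: "card ?S + 3 * (?q - 1) \<le> card ?T"
    using T unfolding S by (simp add: sum.distrib card_Fp_ne_0)
  \<comment> \<open>For fixed \<open>x\<close> and \<open>y\<close> the equation is linear in
    \<open>z\<close>; these are the pairs with a unique and non-zero solution.\<close>
  let ?D = "{(x, y) \<in> ?F \<times> ?F. k * x * y + 1 \<noteq> 0 \<and> x + y + c \<noteq> 0}"
  let ?f = "\<lambda>(x, y). (x, y, - (x + y + c) / (k * x * y + 1))"
  have "card ?D \<le> card ?S"
  proof (rule card_inj_on_le[of ?f])
    show "inj_on ?f ?D" by (auto simp: inj_on_def)
    show "?f ` ?D \<subseteq> ?S"
    proof (rule subsetI)
      fix w assume "w \<in> ?f ` ?D"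
      then obtain x y where w: "w = ?f (x, y)"
        and *: "x \<in> Fp" "y \<in> Fp" "x \<noteq> 0" "y \<noteq> 0" "k * x * y + 1 \<noteq> 0" "x + y + c \<noteq> 0"
        by auto
      define z where "z = - (x + y + c) / (k * x * y + 1)"
      have "z \<in> Fp" using k c * unfolding z_def by blast
      moreover have "z \<noteq> 0"
        using *(5,6) unfolding z_def by (simp only: divide_eq_0_iff neg_equal_0_iff_equal) blast
      moreover have "z * (k * x * y + 1) = - (x + y + c)" using *(5) by (simp add: z_def)
      then have "x + y + z + k * (x * y * z) + c = 0"
        by (simp add: algebra_simps eq_neg_iff_add_eq_0)
      ultimately show "w \<in> ?S" using * unfolding w z_def by simp
    qed
    show "finite ?S" by (auto intro: finite_subset[of _ "?F \<times> ?F \<times> ?F"])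
  qed
  let ?D1 = "(\<lambda>x. (x, - 1 / (k * x))) ` ?F"
  \<comment> \<open>\<open>x = - c\<close> would give \<open>y = 0\<close>, so only
    \<open>p - 2\<close> pairs are lost here.\<close>
  let ?D2 = "(\<lambda>x. (x, - c - x)) ` (?F - {- c})"
  have sub: "?F \<times> ?F \<subseteq> ?D \<union> (?D1 \<union> ?D2)"
  proof (rule subsetI)
    fix w assume "w \<in> ?F \<times> ?F"
    then obtain x y where w: "w = (x, y)" and *: "x \<in> Fp" "y \<in> Fp" "x \<noteq> 0" "y \<noteq> 0"
      by auto
    consider "k * x * y + 1 = 0" | "x + y + c = 0" | "w \<in> ?D" using w * by auto
    then show "w \<in> ?D \<union> (?D1 \<union> ?D2)"
    proof cases
      case 1
      then have "y = - 1 / (k * x)" using k * by (simp add: field_simps eq_neg_iff_add_eq_0)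
      then have "w \<in> ?D1" using w * by auto
      then show ?thesis by blast
    next
      case 2
      then have "y = - c - x" by (simp add: algebra_simps eq_neg_iff_add_eq_0)
      then have "w \<in> ?D2" using w * by auto
      then show ?thesis by blast
    qed blast
  qed
  have "card (?F \<times> ?F) \<le> card (?D \<union> (?D1 \<union> ?D2))"
    by (rule card_mono[OF _ sub]) (auto intro: finite_subset[of _ "?F \<times> ?F"])
  also have "\<dots> \<le> card ?D + (card ?D1 + card ?D2)"
    by (meson card_Un_le le_trans add_left_mono)
  also have "card ?D1 \<le> ?q - 1"
    using card_image_le[of ?F] by (simp add: card_Fp_ne_0)
  also have "card ?D2 \<le> ?q - 2"
    using card_image_le[of "?F - {- c}" "\<lambda>x. (x, - c - x)"] c
    by (simp add: card_Fp_ne_0)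
  finally have "(?q - 1) * (?q - 1) \<le> card ?D + ((?q - 1) + (?q - 2))"
    by (simp add: card_cartesian_product card_Fp_ne_0)
  then have "(?q - 1) * (?q - 1) + 3 * (?q - 1) \<le> card ?T + ((?q - 1) + (?q - 2))"
    using ST \<open>card ?D \<le> card ?S\<close> by linarith
  moreover have "2 \<le> ?q" by (rule prime_ge_2_nat) simp
  then obtain m where "?q = m + 2" by (metis add.commute le_Suc_ex)
  ultimately show ?thesis by (simp add: power2_eq_square algebra_simps)
qed

text \<open>The case of a vanishing linear part, with the same bound. All \<open>p\<close> traces
  together gain \<open>3 p\<close> over at least \<open>(p - 1) ^ 2\<close> triples, which is more
  than enough.\<close>

lemma card_norm_ge:
  fixes n :: "'a :: {alg_closed_field, field_prime_char}"
  assumes n: "n \<in> Fp" "n \<noteq> 0"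
  shows "CHAR('a) ^ 2 + 1 \<le> card {v \<in> Fp3. nm3 v = n} + CHAR('a)"
proof -
  let ?q = "CHAR('a)"
  let ?F = "Fp - {0 :: 'a}"
  let ?S = "{(x, y, z) \<in> Fp \<times> Fp \<times> Fp. x * y * z = n}"
  let ?A = "\<lambda>t. {v \<in> Fp3. tr3 v = t \<and> nm3 v = n}"
  let ?B = "\<lambda>t. {(x, y, z) \<in> Fp \<times> Fp \<times> Fp. x + y + z = t \<and> x * y * z = n}"
  have "card {v \<in> Fp3. nm3 v = n} = (\<Sum>t\<in>Fp. card {v \<in> {v \<in> Fp3. nm3 v = n}. tr3 v = t})"
    by (rule card_fibres) (auto simp: sym3_in_Fp)
  also have "\<dots> = (\<Sum>t\<in>Fp. card (?A t))"
    by (intro sum.cong refl arg_cong[where f = card]) auto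
  finally have T: "card {v \<in> Fp3. nm3 v = n} = (\<Sum>t\<in>Fp. card (?A t))" .
  have fin: "finite ?S" by (auto intro: finite_subset[of _ "Fp \<times> Fp \<times> Fp"])
  have "card ?S = (\<Sum>t\<in>Fp. card {w \<in> ?S. (\<lambda>(x, y, z). x + y + z) w = t})"
    by (rule card_fibres[OF fin]) auto
  also have "\<dots> = (\<Sum>t\<in>Fp. card (?B t))"
    by (intro sum.cong refl arg_cong[where f = card]) auto
  finally have S: "card ?S = (\<Sum>t\<in>Fp. card (?B t))" .
  have "(\<Sum>t\<in>Fp. card (?B t) + 3) \<le> (\<Sum>t\<in>Fp. card (?A t))"
    by (intro sum_mono card_trace_norm_ge) (use n in auto)
  then have "card ?S + 3 * ?q \<le> card {v \<in> Fp3. nm3 v = n}"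
    unfolding S T by (simp add: sum.distrib card_Fp)
  moreover have "card (?F \<times> ?F) \<le> card ?S"
  proof (rule card_inj_on_le[OF _ _ fin, of "\<lambda>(x, y). (x, y, n / (x * y))"])
    show "inj_on (\<lambda>(x, y). (x, y, n / (x * y))) (?F \<times> ?F)" by (auto simp: inj_on_def)
    show "(\<lambda>(x, y). (x, y, n / (x * y))) ` (?F \<times> ?F) \<subseteq> ?S" using n by auto
  qed
  moreover have "2 \<le> ?q" by (rule prime_ge_2_nat) simp
  then obtain m where "?q = m + 2" by (metis add.commute le_Suc_ex)
  ultimately show ?thesis
    by (simp add: card_cartesian_product card_Fp_ne_0 power2_eq_square algebra_simps)
qed

section \<open>Points on plane cubic curves without rational points at infinity\<close>

lemma tr3_add: "tr3 (x + y) = tr3 x + tr3 y"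
  by (simp add: tr3_def frob_simps algebra_simps)

lemma tr3_diff: "tr3 (x - y) = tr3 x - tr3 y"
  by (simp add: tr3_def frob_simps algebra_simps)

lemma tr3_scale: "s \<in> Fp \<Longrightarrow> tr3 (s * x) = s * tr3 x"
  by (simp add: tr3_def frob_simps frob_eq_of_Fp algebra_simps)

text \<open>For \<open>u \<noteq> 0\<close> the substitution \<open>v = u w\<close> normalises the
  trace term and divides the coefficient of the norm by \<open>nm3 u\<close>.\<close>

lemma card_norm_trace_affine_ge:
  fixes u g c :: "'a :: {alg_closed_field, field_prime_char}"
  assumes u: "u \<in> Fp3" and g: "g \<in> Fp" "g \<noteq> 0" and c: "c \<in> Fp" "c \<noteq> 0"
  shows "CHAR('a) ^ 2 + 1 \<le> card {w \<in> Fp3. tr3 (u * w) + g * nm3 w + c = 0} + CHAR('a)"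
    (is "_ \<le> card ?P + _")
proof (cases "u = 0")
  case True
  have "?P = {v \<in> Fp3. nm3 v = - c / g}"
    using g True by (auto simp: tr3_def field_simps eq_neg_iff_add_eq_0)
  moreover have "- c / g \<in> Fp" "- c / g \<noteq> 0" using g c by auto
  ultimately show ?thesis using card_norm_ge[of "- c / g"] by simp
next
  case False
  let ?k = "g / nm3 u"
  let ?T = "{v \<in> Fp3. tr3 v + ?k * nm3 v + c = 0}"
  have k: "?k \<in> Fp" "?k \<noteq> 0" using g False u by (auto simp: sym3_in_Fp)
  have fin: "finite ?P" by (rule finite_subset[of _ Fp3]) auto
  have "card ?T \<le> card ?P"
  proof (rule card_inj_on_le[OF _ _ fin, of "\<lambda>v. v / u"])
    show "inj_on (\<lambda>v. v / u) ?T" using False by (auto simp: inj_on_def)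
    show "(\<lambda>v. v / u) ` ?T \<subseteq> ?P"
    proof (rule image_subsetI)
      fix v assume v: "v \<in> ?T"
      have "nm3 u * nm3 (v / u) = nm3 v" using False by (simp flip: nm3_mult)
      then have "nm3 (v / u) = nm3 v / nm3 u"
        using False by (simp add: field_simps)
      then show "v / u \<in> ?P" using v u False by (simp add: Fp3_closed)
    qed
  qed
  then show ?thesis using card_trace_norm_line_ge[OF k c] by linarith
qed

text \<open>
  The cubic part of the equation is \<open>a nm3 w\<close> on the plane \<open>w = x + y h\<close> in \<open>Fp3\<close>, where \<open>h\<close> is minus a
  root of \<open>a T\<^sup>3 + b T + d\<close>.  This plane is the kernel of \<open>tr3 (n w)\<close>, and the whole equation takes the
  form \<open>g w = 0\<close> there.  If it has no solution, then the sets \<open>s tr3 (n w) + g w = 0\<close> are pairwise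
  disjoint for \<open>s \<in> Fp\<close> and avoid the plane, which contradicts the lower bound for their sizes.
\<close>

lemma cubic_curve_has_point:
  fixes a b c d l m :: "'a :: {alg_closed_field, field_prime_char}"
  assumes coeffs: "a \<in> Fp" "b \<in> Fp" "c \<in> Fp" "d \<in> Fp" "l \<in> Fp" "m \<in> Fp"
    and a: "a \<noteq> 0" and c: "c \<noteq> 0"
    and no_root: "\<And>r. r \<in> Fp \<Longrightarrow> a * r ^ 3 + b * r + d \<noteq> 0"
  shows "\<exists>x\<in>Fp. \<exists>y\<in>Fp. a * x ^ 3 + b * x * y ^ 2 + d * y ^ 3 + l * x + m * y + c = 0"
proof (rule ccontr)
  assume no_point: "\<not> ?thesis"
  let ?q = "CHAR('a)"
  have cf: "0 \<in> Fp" "b / a \<in> Fp" "- (d / a) \<in> Fp" using coeffs by auto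
  have nr: "\<forall>r\<in>Fp. r ^ 3 + 0 * r ^ 2 + b / a * r + - (d / a) \<noteq> 0"
  proof (intro ballI notI)
    fix r :: 'a assume r: "r \<in> Fp"
    assume "r ^ 3 + 0 * r ^ 2 + b / a * r + - (d / a) = 0"
    moreover have "a * (- r) ^ 3 + b * (- r) + d = - a * (r ^ 3 + 0 * r ^ 2 + b / a * r + - (d / a))"
      using a by (simp add: algebra_simps)
    ultimately have "a * (- r) ^ 3 + b * (- r) + d = 0" by simp
    then show False using no_root[of "- r"] r by auto
  qed
  obtain h where "poly [:- (d / a), b / a, 0, 1:] h = 0"
    using alg_closed_imp_poly_has_root[of "[:- (d / a), b / a, 0, 1:]"] by auto
  then have h: "h ^ 3 + 0 * h ^ 2 + b / a * h + - (d / a) = 0"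
    by (simp add: algebra_simps power2_eq_square power3_eq_cube)
  define h2 where "h2 = frob h"
  define h3 where "h3 = frob h2"
  note irr = irreducible_cubic_root[OF cf nr h, folded h2_def, folded h3_def]
  have hK: "h \<in> Fp3" using irr(4) by (simp add: Fp3_def h2_def h3_def)
  \<comment> \<open>\<open>n\<close> is orthogonal to \<open>1\<close> and \<open>h\<close> under
    the trace form, so \<open>tr3 (n * w)\<close> vanishes on the plane. Its value \<open>D\<close>
    at \<open>n * h ^ 2\<close> is up to sign the product of the differences of the conjugates,
    hence not \<open>0\<close>.\<close>
  define n where "n = h2 - h3"
  define D where "D = h ^ 2 * (h2 - h3) + h2 ^ 2 * (h3 - h) + h3 ^ 2 * (h - h2)"
  have "D = - ((h - h2) * (h2 - h3) * (h3 - h))"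
    by (simp add: D_def algebra_simps power2_eq_square)
  then have D0: "D \<noteq> 0" using irr(1-3) by simp
  have fr: "frob h = h2" "frob h2 = h3" "frob h3 = h"
    using irr(4) by (simp_all add: h2_def h3_def)
  have DF: "D \<in> Fp" by (simp add: Fp_def D_def frob_simps fr algebra_simps)
  have nK: "n \<in> Fp3" using hK by (simp add: n_def h2_def h3_def Fp3_frob Fp3_closed)
  have sum0: "h3 = - h - h2" using irr(5) by (simp add: algebra_simps eq_neg_iff_add_eq_0)
  have tr_n: "tr3 n = 0" "tr3 (n * h) = 0" "tr3 (n * h ^ 2) = D"
    by (simp_all add: tr3_def n_def D_def frob_simps fr algebra_simps power2_eq_square)
  have "tr3 (n * h ^ 3) = D * (h + h2 + h3)"
    by (simp add: tr3_def n_def D_def frob_simps fr algebra_simps power2_eq_square power3_eq_cube)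
  then have tr_n3: "tr3 (n * h ^ 3) = 0" using irr(5) by simp
  have affine: "\<exists>x\<in>Fp. \<exists>y\<in>Fp. w = x + y * h" if w: "w \<in> Fp3" "tr3 (n * w) = 0" for w
  proof -
    define w2 where "w2 = frob w"
    define w3 where "w3 = frob w2"
    define y where "y = (w - w2) / (h - h2)"
    \<comment> \<open>The slope \<open>(w - w2) / (h - h2)\<close> agrees with its conjugate because
      \<open>tr3 (n * w) = 0\<close>, so it lies in \<open>Fp\<close>.\<close>
    have "(w - w2) * (h2 - h3) - (w2 - w3) * (h - h2) = tr3 (n * w)"
      by (simp add: tr3_def n_def frob_simps fr w2_def w3_def algebra_simps)
    then have "(w2 - w3) / (h2 - h3) = (w - w2) / (h - h2)"
      using irr(1-3) w(2) by (simp add: field_simps)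
    then have y: "frob y = y" by (simp add: y_def frob_simps fr w2_def w3_def)
    have "w - w2 = y * (h - h2)" using irr(1) by (simp add: y_def)
    then have "frob (w - y * h) = w - y * h"
      using y by (simp add: frob_simps fr w2_def[symmetric] algebra_simps)
    then show ?thesis using y by (intro bexI[of _ "w - y * h"] bexI[of _ y]) (auto simp: Fp_def)
  qed
  have nm: "a * nm3 (x + y * h) = a * x ^ 3 + b * x * y ^ 2 + d * y ^ 3" if "x \<in> Fp" "y \<in> Fp" for x y
  proof -
    have "nm3 (x + y * h) = (x + y * h) * (x + y * h2) * (x + y * h3)"
      using that by (simp add: nm3_def frob_simps fr frob_eq_of_Fp)
    also have "\<dots> = x ^ 3 + (h + h2 + h3) * x ^ 2 * y + (h * h2 + h * h3 + h2 * h3) * x * y ^ 2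
        + h * h2 * h3 * y ^ 3"
      by (simp add: algebra_simps power2_eq_square power3_eq_cube)
    also have "\<dots> = x ^ 3 + b / a * x * y ^ 2 + d / a * y ^ 3"
      unfolding irr(5-7) by simp
    finally show ?thesis using a by (simp add: field_simps)
  qed
  \<comment> \<open>\<open>u 0\<close> is chosen such that
    \<open>tr3 (u 0 * w) = D * (l * x + m * y)\<close> on the plane; there the equation of
    \<open>P s\<close> is \<open>D\<close> times that of the curve.\<close>
  define u where "u s = n * (s + l * h ^ 2 + m * h)" for s
  define P where "P s = {w \<in> Fp3. tr3 (u s * w) + D * a * nm3 w + D * c = 0}" for s
  have tr_u: "tr3 (u s * w) = s * tr3 (n * w) + tr3 (u 0 * w)" if "s \<in> Fp" for s w
  proof -
    have "u s * w = s * (n * w) + u 0 * w" by (simp add: u_def algebra_simps)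
    then show ?thesis using that by (simp add: tr3_add tr3_scale)
  qed
  have nz: "tr3 (n * w) \<noteq> 0" if "w \<in> P s" "s \<in> Fp" for w s
  proof
    assume 0: "tr3 (n * w) = 0"
    with that obtain x y where xy: "x \<in> Fp" "y \<in> Fp" "w = x + y * h"
      using affine[of w] by (auto simp: P_def)
    have "u 0 * w = (l * x) * (n * h ^ 2) + (m * x) * (n * h) + (l * y) * (n * h ^ 3)
        + (m * y) * (n * h ^ 2)"
      by (simp add: u_def xy(3) algebra_simps power2_eq_square power3_eq_cube)
    then have "tr3 (u 0 * w) = tr3 ((l * x) * (n * h ^ 2)) + tr3 ((m * x) * (n * h))
        + tr3 ((l * y) * (n * h ^ 3)) + tr3 ((m * y) * (n * h ^ 2))"
      by (simp only: tr3_add)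
    also have "\<dots> = (l * x) * D + (m * y) * D"
      using coeffs xy by (subst (1 2 3 4) tr3_scale) (auto simp: tr_n tr_n3)
    also have "\<dots> = D * (l * x + m * y)" by (simp add: algebra_simps)
    finally have "tr3 (u 0 * w) = D * (l * x + m * y)" .
    then have "D * (l * x + m * y + a * nm3 w + c) = 0"
      using that tr_u[of s w] 0 by (simp add: P_def algebra_simps)
    then have "l * x + m * y + a * nm3 w + c = 0" using D0 by simp
    then have "a * x ^ 3 + b * x * y ^ 2 + d * y ^ 3 + l * x + m * y + c = 0"
      unfolding xy(3) nm[OF xy(1,2)] by (simp add: algebra_simps)
    then show False using no_point xy by blast
  qed
  have disj: "P s \<inter> P s' = {}" if "s \<in> Fp" "s' \<in> Fp" "s \<noteq> s'" for s s'
  proof (rule ccontr)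
    assume "P s \<inter> P s' \<noteq> {}"
    then obtain w where w: "w \<in> P s" "w \<in> P s'" by blast
    \<comment> \<open>The two equations differ by \<open>(s - s') * tr3 (n * w)\<close>, so
      \<open>w\<close> would lie on the plane, which \<open>P s\<close> avoids.\<close>
    then have "s * tr3 (n * w) + tr3 (u 0 * w) = s' * tr3 (n * w) + tr3 (u 0 * w)"
      unfolding tr_u[OF that(1), symmetric] tr_u[OF that(2), symmetric] P_def
      by (auto simp: add.assoc) (metis add_right_cancel)
    then show False using nz[OF w(1)] that by simp
  qed
  have fin: "finite (P s)" for s by (rule finite_subset[of _ Fp3]) (auto simp: P_def)
  \<comment> \<open>The \<open>p\<close> disjoint sets have at least
    \<open>p ^ 3 - p ^ 2 + p\<close> elements together, but only \<open>p ^ 3 - p ^ 2\<close> are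
    available outside the plane.\<close>
  have "?q * (?q ^ 2 + 1) = (\<Sum>s\<in>(Fp :: 'a set). ?q ^ 2 + 1)" by (simp add: card_Fp)
  also have "\<dots> \<le> (\<Sum>s\<in>Fp. card (P s) + ?q)"
  proof (rule sum_mono)
    fix s :: 'a assume s: "s \<in> Fp"
    have "u s \<in> Fp3"
      using coeffs s hK nK unfolding u_def by (intro Fp3_closed) (auto intro: Fp_subset_Fp3)
    moreover have "D * a \<in> Fp" "D * a \<noteq> 0" "D * c \<in> Fp" "D * c \<noteq> 0"
      using DF D0 coeffs a c by auto
    ultimately show "?q ^ 2 + 1 \<le> card (P s) + ?q"
      unfolding P_def by (rule card_norm_trace_affine_ge)
  qed
  also have "\<dots> = card (\<Union>s\<in>Fp. P s) + ?q * ?q"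
    by (subst card_UN_disjoint) (auto simp: fin disj sum.distrib card_Fp)
  also have "card (\<Union>s\<in>Fp. P s) \<le> card ((\<lambda>(x, y, z). x + y * h + z * h ^ 2) ` (Fp \<times> Fp \<times> (Fp - {0})))"
  proof (rule card_mono)
    show "(\<Union>s\<in>Fp. P s) \<subseteq> (\<lambda>(x, y, z). x + y * h + z * h ^ 2) ` (Fp \<times> Fp \<times> (Fp - {0}))"
    proof (rule UN_least, rule subsetI)
      fix s w assume s: "s \<in> Fp" and w: "w \<in> P s"
      define z where "z = tr3 (n * w) / D"
      have wK: "w \<in> Fp3" using w by (simp add: P_def)
      have zF: "z \<in> Fp" using DF wK nK by (simp add: z_def sym3_in_Fp Fp3_closed)
      have z0: "z \<noteq> 0" using nz[OF w s] D0 by (simp add: z_def)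
      have "w - z * h ^ 2 \<in> Fp3"
        using wK zF hK by (intro Fp3_closed) (auto intro: Fp_subset_Fp3)
      moreover have "n * (w - z * h ^ 2) = n * w - z * (n * h ^ 2)" by (simp add: algebra_simps)
      then have "tr3 (n * (w - z * h ^ 2)) = tr3 (n * w) - z * D"
        using zF by (simp add: tr3_diff tr3_scale tr_n)
      then have "tr3 (n * (w - z * h ^ 2)) = 0" using D0 by (simp add: z_def)
      ultimately obtain x y where "x \<in> Fp" "y \<in> Fp" "w - z * h ^ 2 = x + y * h"
        using affine by blast
      then have "w = (\<lambda>(x, y, z). x + y * h + z * h ^ 2) (x, y, z)" by (simp add: algebra_simps)
      then show "w \<in> (\<lambda>(x, y, z). x + y * h + z * h ^ 2) ` (Fp \<times> Fp \<times> (Fp - {0}))"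
        by (rule image_eqI) (use \<open>x \<in> Fp\<close> \<open>y \<in> Fp\<close> zF z0 in auto)
    qed
  qed auto
  also have "\<dots> \<le> card (Fp \<times> Fp \<times> (Fp - {0 :: 'a}) :: ('a \<times> 'a \<times> 'a) set)"
    by (rule card_image_le) auto
  also have "\<dots> = ?q * (?q * (?q - 1))"
    by (simp add: card_cartesian_product card_Fp)
  finally have "?q * (?q ^ 2 + 1) \<le> ?q * (?q * (?q - 1)) + ?q * ?q" by simp
  moreover obtain k where "?q = Suc k" using CHAR_pos[where 'a = 'a] by (metis gr0_implies_Suc)
  ultimately show False by (simp add: power2_eq_square algebra_simps)
qed

section \<open>The ring of \<open>p\<close>-adic integers\<close>

definition padic_p :: "'p :: prime_card padic_int" where
  "padic_p = of_nat CARD('p)"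

lemma padic_residue_0 [simp]: "padic_residue 0 n = 0"
  by (simp add: zero_padic_int.rep_eq)

lemma padic_residue_of_nat:
  "padic_residue (of_nat k :: 'p :: prime_card padic_int) n = int k mod int CARD('p) ^ n"
  by (induction k)
    (simp_all add: zero_padic_int.rep_eq one_padic_int.rep_eq plus_padic_int.rep_eq mod_simps)

lemma padic_residue_of_int:
  "padic_residue (of_int k :: 'p :: prime_card padic_int) n = k mod int CARD('p) ^ n"
  by (cases k rule: int_cases2)
    (simp_all add: padic_residue_of_nat uminus_padic_int.rep_eq mod_simps)

lemma padic_residue_p_power:
  "padic_residue (padic_p ^ k :: 'p :: prime_card padic_int) n = int CARD('p) ^ k mod int CARD('p) ^ n"
  unfolding padic_p_def of_nat_power[symmetric] padic_residue_of_nat ..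

lemma padic_eqI: "(\<And>n. padic_residue x n = padic_residue y n) \<Longrightarrow> x = y"
  by (simp add: padic_residue_inject[symmetric] fun_eq_iff)

lemma padic_residue_Abs:
  assumes "\<And>n. f n = f (Suc n) mod int CARD('p :: prime_card) ^ n"
  shows "padic_residue (Abs_padic_int f :: 'p padic_int) n = f n"
proof -
  have "f \<in> {f. \<forall>n. f n = f (Suc n) mod int CARD('p) ^ n}"
    using assms by (intro CollectI allI)
  then show ?thesis by (simp only: Abs_padic_int_inverse)
qed

lemma p_power_dvd_iff:
  fixes x :: "'p :: prime_card padic_int"
  shows "padic_p ^ n dvd x \<longleftrightarrow> padic_residue x n = 0"
proof
  assume "padic_p ^ n dvd x"
  then show "padic_residue x n = 0"
    by (auto simp: dvd_def times_padic_int.rep_eq padic_residue_p_power)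
next
  assume 0: "padic_residue x n = 0"
  let ?p = "int CARD('p)"
  \<comment> \<open>Division by \<open>p ^ n\<close> costs \<open>n\<close> digits, so the quotient
    modulo \<open>p ^ m\<close> is read off from level \<open>m + n\<close>.\<close>
  define f where "f m = padic_residue x (m + n) div ?p ^ n" for m
  have pn: "0 < ?p ^ n" by simp
  have f: "f m = f (Suc m) mod ?p ^ m" for m
  proof -
    have "f m = (padic_residue x (Suc m + n) mod (?p ^ n * ?p ^ m)) div ?p ^ n"
      using padic_residue_Suc_mod[of x "m + n"] by (simp add: f_def power_add mult.commute)
    also have "\<dots> = f (Suc m) mod ?p ^ m"
      using pn by (simp add: f_def zmod_zmult2_eq)
    finally show ?thesis .
  qed
  have "x = padic_p ^ n * (Abs_padic_int f :: 'p padic_int)"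
  proof (rule padic_eqI)
    fix m
    have "padic_residue x (m + n) mod ?p ^ n = 0"
      using 0 padic_residue_mod_le[of n "m + n" x] by simp
    then have "?p ^ n * f m = padic_residue x (m + n)"
      unfolding f_def by (simp add: dvd_eq_mod_eq_0)
    then show "padic_residue x m = padic_residue (padic_p ^ n * (Abs_padic_int f :: 'p padic_int)) m"
      using padic_residue_mod_le[of m "m + n" x]
      by (simp add: times_padic_int.rep_eq padic_residue_p_power padic_residue_Abs[OF f] mod_simps)
  qed
  then show "padic_p ^ n dvd x" by simp
qed

lemma p_dvd_iff: "padic_p dvd x \<longleftrightarrow> padic_residue x 1 = 0"
  using p_power_dvd_iff[of 1 x] by simp

lemma padic_eq_0I: "(\<And>n. padic_p ^ n dvd x) \<Longrightarrow> x = 0"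
  by (rule padic_eqI) (simp add: p_power_dvd_iff)

text \<open>With this rate of convergence the \<open>n\<close>-th residue no longer changes from
  \<open>s n\<close> on, so the residues of \<open>s n\<close> at level \<open>n\<close> form the
  limit.\<close>

lemma padic_complete:
  fixes s :: "nat \<Rightarrow> 'p :: prime_card padic_int"
  assumes s: "\<And>n. padic_p ^ n dvd s (Suc n) - s n"
  obtains y where "\<And>n. padic_p ^ n dvd y - s n"
proof -
  let ?p = "int CARD('p)"
  define f where "f n = padic_residue (s n) n" for n
  have res: "padic_residue x n = padic_residue y n" if "padic_p ^ n dvd x - y"
    for x y :: "'p padic_int" and n
  proof -
    have "(padic_residue x n - padic_residue y n) mod ?p ^ n = 0"
      using that by (simp add: p_power_dvd_iff minus_padic_int.rep_eq)
    then have "padic_residue x n mod ?p ^ n = padic_residue y n mod ?p ^ n"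
      by (simp add: mod_eq_dvd_iff dvd_eq_mod_eq_0)
    then show ?thesis by (simp add: padic_residue_mod)
  qed
  have f: "f n = f (Suc n) mod ?p ^ n" for n
    using res[OF s[of n]] padic_residue_Suc_mod[of "s (Suc n)" n] by (simp add: f_def)
  have "padic_p ^ n dvd (Abs_padic_int f :: 'p padic_int) - s n" for n
    by (simp add: p_power_dvd_iff minus_padic_int.rep_eq padic_residue_Abs[OF f])
      (simp add: f_def)
  then show ?thesis by (rule that)
qed

lemma prime_elem_padic_p: "prime_elem (padic_p :: 'p :: prime_card padic_int)"
proof (rule prime_elemI)
  let ?p = "int CARD('p)"
  have p: "1 < ?p" by (rule prime_gt_1_int[OF prime_card_int])
  \<comment> \<open>Seen modulo \<open>p ^ 2\<close>, since the residue at level 1 is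
    \<open>0\<close>.\<close>
  show "(padic_p :: 'p padic_int) \<noteq> 0"
    using p padic_residue_p_power[where 'p = 'p, of 1 2] by (auto simp: power2_eq_square)
  show "\<not> (padic_p :: 'p padic_int) dvd 1"
    using p by (simp add: p_dvd_iff one_padic_int.rep_eq)
  fix a b :: "'p padic_int"
  assume "padic_p dvd a * b"
  then have "?p dvd padic_residue a 1 * padic_residue b 1"
    by (simp add: p_dvd_iff times_padic_int.rep_eq dvd_eq_mod_eq_0)
  then have "?p dvd padic_residue a 1 \<or> ?p dvd padic_residue b 1"
    by (rule prime_dvd_multD[OF prime_card_int])
  then show "padic_p dvd a \<or> padic_p dvd b"
    using padic_residue_mod[of a 1] padic_residue_mod[of b 1]
    by (auto simp: p_dvd_iff dvd_eq_mod_eq_0)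
qed

lemma padic_p_neq_0 [simp]: "padic_p \<noteq> 0"
  using prime_elem_padic_p prime_elem_def by blast

text \<open>An inverse \<open>t\<close> modulo \<open>p\<close> gives
  \<open>x * t = 1 - p * u\<close>, and the geometric series in \<open>p * u\<close>
  converges.\<close>

lemma padic_unit_iff: "x dvd 1 \<longleftrightarrow> \<not> padic_p dvd (x :: 'p :: prime_card padic_int)"
proof
  assume "x dvd 1"
  then show "\<not> padic_p dvd x"
    using prime_elem_padic_p by (meson dvd_trans not_prime_elem_one prime_elem_def)
next
  let ?p = "int CARD('p)"
  assume x: "\<not> padic_p dvd x"
  have "\<not> ?p dvd padic_residue x 1"
    using x padic_residue_mod[of x 1] by (auto simp: p_dvd_iff dvd_eq_mod_eq_0)
  then have "coprime (padic_residue x 1) ?p"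
    by (metis prime_imp_coprime coprime_commute prime_card_int)
  then obtain k where k: "(padic_residue x 1 * k) mod ?p = 1 mod ?p"
    using cong_solve_coprime_int[of "padic_residue x 1" ?p] by (auto simp: cong_def)
  define t :: "'p padic_int" where "t = of_int k"
  have "padic_p dvd 1 - x * t"
  proof -
    have "padic_residue (1 - x * t) 1 = (1 mod ?p - (padic_residue x 1 * k) mod ?p) mod ?p"
      by (simp only: minus_padic_int.rep_eq times_padic_int.rep_eq one_padic_int.rep_eq t_def
          padic_residue_of_int power_one_right mod_mult_right_eq)
    then show ?thesis unfolding k p_dvd_iff by simp
  qed
  then obtain u where u: "1 - x * t = padic_p * u" by (auto simp: dvd_def)
  define s where "s n = t * (\<Sum>i<n. (padic_p * u) ^ i)" for n
  have "padic_p ^ n dvd s (Suc n) - s n" for n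
    by (simp add: s_def algebra_simps power_mult_distrib)
  then obtain y where y: "\<And>n. padic_p ^ n dvd y - s n" by (rule padic_complete) blast
  have "x * y - 1 = 0"
  proof (rule padic_eq_0I)
    fix n
    have "x * s n - 1 = - ((padic_p * u) ^ n)"
    proof (induction n)
      case (Suc n)
      have "x * s (Suc n) - 1 = (x * s n - 1) + (x * t) * (padic_p * u) ^ n"
        by (simp add: s_def algebra_simps)
      also have "x * t = 1 - padic_p * u" using u by (simp add: algebra_simps)
      finally show ?case unfolding Suc by (simp add: algebra_simps)
    qed (simp add: s_def)
    moreover have "x * y - 1 = x * (y - s n) + (x * s n - 1)" by (simp add: algebra_simps)
    ultimately show "padic_p ^ n dvd x * y - 1"
      using y[of n] by (simp add: power_mult_distrib)
  qed
  then show "x dvd 1" by (metis dvd_triv_left eq_iff_diff_eq_0)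
qed

lemma padic_unit_decomp:
  fixes x :: "'p :: prime_card padic_int"
  assumes "x \<noteq> 0"
  obtains n u where "x = padic_p ^ n * u" "u dvd 1"
proof -
  have ex: "\<exists>n. \<not> padic_p ^ n dvd x" using assms padic_eq_0I by blast
  \<comment> \<open>One more than the valuation; it is positive since \<open>p ^ 0\<close> divides
    everything.\<close>
  define n where "n = (LEAST n. \<not> padic_p ^ n dvd x)"
  have n: "\<not> padic_p ^ n dvd x" unfolding n_def by (rule LeastI_ex[OF ex])
  then obtain m where m: "n = Suc m" by (cases n) auto
  then have "padic_p ^ m dvd x" using not_less_Least[of m "\<lambda>n. \<not> padic_p ^ n dvd x"]
    by (auto simp: n_def)
  then obtain u where u: "x = padic_p ^ m * u" by (auto simp: dvd_def)
  have "\<not> padic_p dvd u"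
  proof
    assume "padic_p dvd u"
    then have "padic_p ^ n dvd x" unfolding u m by (simp add: mult.commute mult_dvd_mono)
    with n show False by simp
  qed
  then show ?thesis using that u by (simp add: padic_unit_iff)
qed

text \<open>Newton iteration; the derivative stays a unit because it only changes by multiples of
  \<open>p\<close>.\<close>

lemma padic_hensel_cubic:
  fixes a b c x0 :: "'p :: prime_card padic_int"
  assumes root: "padic_p dvd a * x0 ^ 3 + b * x0 + c"
    and simple_root: "\<not> padic_p dvd 3 * a * x0 ^ 2 + b"
  obtains x where "a * x ^ 3 + b * x + c = 0"
proof -
  define f where "f x = a * x ^ 3 + b * x + c" for x
  define f' where "f' x = 3 * a * x ^ 2 + b" for x
  \<comment> \<open>An inverse of the derivative inside the ring, meaningful only where
    \<open>f' x\<close> is a unit.\<close>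
  define f_inv where "f_inv x = (SOME y. f' x * y = 1)" for x
  have f_inv: "f' x * f_inv x = 1" if "\<not> padic_p dvd f' x" for x
  proof -
    have "f' x dvd 1" using that by (simp add: padic_unit_iff)
    then have "\<exists>y. f' x * y = 1" by (metis dvd_def)
    then show ?thesis unfolding f_inv_def by (rule someI_ex)
  qed
  define s where "s n = ((\<lambda>x. x - f x * f_inv x) ^^ n) x0" for n
  have s_Suc: "s (Suc n) = s n - f (s n) * f_inv (s n)" for n by (simp add: s_def)
  have step: "padic_p ^ Suc n dvd f (s n) \<and> \<not> padic_p dvd f' (s n)" for n
  proof (induction n)
    case 0
    then show ?case using assms by (simp add: s_def f_def f'_def)
  next
    case (Suc n)
    define x where "x = s n"
    define h where "h = - f x * f_inv x"
    have IH: "padic_p ^ Suc n dvd f x" "\<not> padic_p dvd f' x" using Suc by (auto simp: x_def)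
    have sx: "s (Suc n) = x + h" by (simp add: s_Suc x_def h_def)
    have h: "padic_p ^ Suc n dvd h" using IH(1) by (simp add: h_def)
    \<comment> \<open>Taylor expansion: the choice of \<open>h\<close> cancels the first two terms,
      and \<open>h ^ 2\<close> is divisible by \<open>p ^ (2 * n + 2)\<close>, of which
      \<open>n + 2\<close> factors suffice.\<close>
    have "f (x + h) = f x + h * f' x + h ^ 2 * (3 * a * x + a * h)"
      by (simp add: f_def f'_def algebra_simps power2_eq_square power3_eq_cube)
    also have "f x + h * f' x = f x * (1 - f' x * f_inv x)" by (simp add: h_def algebra_simps)
    also have "\<dots> = 0" using f_inv[OF IH(2)] by simp
    finally have fx: "f (x + h) = h ^ 2 * (3 * a * x + a * h)" by simp
    have "padic_p ^ (Suc n + Suc n) dvd h * h"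
      unfolding power_add using h by (intro mult_dvd_mono)
    then have "padic_p ^ Suc (Suc n) dvd h * h"
      by (rule dvd_trans[rotated]) (intro le_imp_power_dvd, simp)
    then have 1: "padic_p ^ Suc (Suc n) dvd f (x + h)"
      unfolding fx by (simp add: power2_eq_square dvd_mult2)
    have "padic_p dvd h" using h by (metis dvd_mult_left power_Suc)
    moreover have "f' (x + h) = f' x + h * (6 * a * x + 3 * a * h)"
      by (simp add: f'_def algebra_simps power2_eq_square)
    ultimately have "\<not> padic_p dvd f' (x + h)"
      using IH(2) by (simp add: dvd_add_left_iff)
    with 1 show ?case by (simp add: sx)
  qed
  have "padic_p ^ n dvd s (Suc n) - s n" for n
  proof -
    have "padic_p ^ n dvd f (s n)" using step[of n] by (metis dvd_mult_right power_Suc)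
    then show ?thesis by (simp add: s_Suc)
  qed
  then obtain y where y: "\<And>n. padic_p ^ n dvd y - s n" by (rule padic_complete) blast
  have "f y = 0"
  proof (rule padic_eq_0I)
    fix n
    define x where "x = s n"
    define h where "h = y - x"
    have "y = x + h" by (simp add: h_def)
    then have "f y = f x + h * (3 * a * x ^ 2 + b + 3 * a * x * h + a * h ^ 2)"
      by (simp add: f_def algebra_simps power2_eq_square power3_eq_cube)
    moreover have "padic_p ^ n dvd f x"
      using step[of n] unfolding x_def by (metis dvd_mult_right power_Suc)
    moreover have "padic_p ^ n dvd h" using y by (simp add: h_def x_def)
    ultimately show "padic_p ^ n dvd f y" by (simp add: dvd_mult2)
  qed
  then show ?thesis using that by (simp add: f_def)
qed

section \<open>Binary and ternary cubic forms with unit coefficients\<close>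

instance alg_closure :: (field_prime_char) field_prime_char
proof (rule field_prime_charI')
  show "0 < CHAR('a alg_closure)" by simp
qed

text \<open>The values lie in an algebraic closure because the point count takes place there; the
  image is the subfield \<open>Fp\<close>.\<close>

definition padic_red :: "'p :: prime_card padic_int \<Rightarrow> 'p mod_ring alg_closure" where
  "padic_red x = of_int (padic_residue x 1)"

lemma of_int_mod_card:
  "(of_int (k mod int CARD('p)) :: 'p :: prime_card mod_ring alg_closure) = of_int k"
  using of_int_mod_CHAR[where 'a = "'p mod_ring alg_closure", of k] by simp

lemma padic_red_add: "padic_red (x + y) = padic_red x + padic_red y"
  by (simp add: padic_red_def plus_padic_int.rep_eq of_int_mod_card)

lemma padic_red_mult: "padic_red (x * y) = padic_red x * padic_red y"
  by (simp add: padic_red_def times_padic_int.rep_eq of_int_mod_card)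

lemma padic_red_power: "padic_red (x ^ k) = padic_red x ^ k"
  by (induction k) (simp_all add: padic_red_mult, simp add: padic_red_def one_padic_int.rep_eq
      of_int_mod_card)

lemma padic_red_eq_0_iff: "padic_red x = 0 \<longleftrightarrow> padic_p dvd x"
proof -
  have "padic_red x = 0 \<longleftrightarrow> int CARD('a) dvd padic_residue x 1"
    by (simp add: padic_red_def of_int_eq_0_iff_char_dvd)
  then show ?thesis
    using padic_residue_mod[of x 1] by (auto simp: p_dvd_iff dvd_eq_mod_eq_0)
qed

lemma padic_red_in_Fp: "padic_red x \<in> Fp"
  by (simp add: padic_red_def Fp_def)

lemma Fp_padic_red:
  assumes "y \<in> Fp"
  obtains x where "padic_red x = y"
proof -
  from assms obtain k where "y = of_nat k" by (auto simp: Fp_eq)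
  then have "padic_red (of_nat k) = y"
    using of_int_mod_card[where 'p = 'a, of "int k"] by (simp add: padic_red_def padic_residue_of_nat)
  then show ?thesis by (rule that)
qed

lemma p_not_dvd_3:
  assumes "CARD('p :: prime_card) \<noteq> 3"
  shows "\<not> padic_p dvd (3 :: 'p padic_int)"
proof
  assume "padic_p dvd (3 :: 'p padic_int)"
  then have "3 mod int CARD('p) = 0"
    using padic_residue_of_nat[where 'p = 'p, of 3 1] by (simp add: p_dvd_iff)
  then have "CARD('p) dvd 3" by presburger
  then show False
    using assms primes_dvd_imp_eq[of "CARD('p)" 3] prime_card[where 'a = 'p] by simp
qed

lemma p_dvd_mult_iff: "padic_p dvd x * y \<longleftrightarrow> padic_p dvd x \<or> padic_p dvd y"
  using prime_elem_dvd_mult_iff[OF prime_elem_padic_p] .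

lemma p_dvd_power_iff: "0 < n \<Longrightarrow> padic_p dvd x ^ n \<longleftrightarrow> padic_p dvd x"
proof (induction n)
  case (Suc n)
  then show ?case by (cases n) (simp_all add: p_dvd_mult_iff)
qed simp

lemma to_fract_power: "to_fract (x ^ n) = to_fract x ^ n"
  by (induction n) simp_all

text \<open>Compare the exponents of \<open>p\<close> in numerator and denominator.\<close>

lemma padic_integral_or_inverse:
  fixes z :: "'p :: prime_card padic"
  obtains b where "z = to_fract b" | d where "padic_p dvd d" "z * to_fract d = 1"
proof (cases z)
  case (Fract x y)
  show ?thesis
  proof (cases "x = 0")
    case True
    then show ?thesis using Fract that(1)[of 0] by (simp add: fract_collapse)
  next
    case False
    then obtain m u where x: "x = padic_p ^ m * u" "u dvd 1" by (rule padic_unit_decomp)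
    from Fract(2) obtain n w where y: "y = padic_p ^ n * w" "w dvd 1" by (rule padic_unit_decomp)
    from x(2) obtain u' where u': "1 = u * u'" by (auto simp: dvd_def)
    from y(2) obtain w' where w': "1 = w * w'" by (auto simp: dvd_def)
    show ?thesis
    proof (cases "n \<le> m")
      case True
      have "x * 1 = (padic_p ^ (m - n) * u * w') * y"
        unfolding w' x(1) y(1) using True by (simp add: mult_ac flip: power_add)
      then have "z = to_fract (padic_p ^ (m - n) * u * w')"
        using Fract by (simp add: to_fract_def eq_fract del: mult_1_right)
      then show ?thesis by (rule that(1))
    next
      case False
      define d where "d = padic_p ^ (n - m) * w * u'"
      have "x * d = y * 1"
        unfolding u' x(1) y(1) d_def using False by (simp add: mult_ac flip: power_add)
      then have "z * to_fract d = 1"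
        using Fract by (simp add: to_fract_def One_fract_def eq_fract)
      moreover have "padic_p dvd d" using False by (simp add: d_def p_dvd_mult_iff p_dvd_power_iff)
      ultimately show ?thesis using that(2) by blast
    qed
  qed
qed

text \<open>A root modulo \<open>p\<close> that is not simple is double, and then the third root is
  simple and lifts. A non-integral \<open>\<beta>\<close> dominates the other coefficients after
  rescaling.\<close>

lemma binary_cubic_zero_or_no_root:
  fixes a c :: "'p :: prime_card padic_int" and \<beta> :: "'p padic"
  assumes p3: "CARD('p) \<noteq> 3" and a: "a dvd 1" and c: "c dvd 1"
  shows "(\<exists>t s. (t \<noteq> 0 \<or> s \<noteq> 0) \<and> to_fract a * t ^ 3 + \<beta> * t * s ^ 2 + to_fract c * s ^ 3 = 0)
    \<or> (\<exists>b. \<beta> = to_fract b \<and> (\<forall>x. \<not> padic_p dvd a * x ^ 3 + b * x + c))"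
  (is "?zero \<or> ?no_root")
proof (cases rule: padic_integral_or_inverse[of \<beta>])
  case (1 b)
  have zero: ?zero if "a * x ^ 3 + b * x + c = 0" for x
  proof -
    have "to_fract (a * x ^ 3 + b * x + c) = 0" using that by simp
    then have "to_fract a * to_fract x ^ 3 + \<beta> * to_fract x * 1 ^ 2 + to_fract c * 1 ^ 3 = 0"
      by (simp add: 1 to_fract_power)
    then show ?thesis by (intro exI[of _ "to_fract x"] exI[of _ 1]) simp
  qed
  show ?thesis
  proof (cases "\<exists>x. padic_p dvd a * x ^ 3 + b * x + c")
    case False
    then show ?thesis using 1 by blast
  next
    case True
    then obtain x where x: "padic_p dvd a * x ^ 3 + b * x + c" by blast
    show ?thesis
    proof (cases "padic_p dvd 3 * a * x ^ 2 + b")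
      case False
      then show ?thesis using padic_hensel_cubic[OF x False] zero by blast
    next
      case True
      \<comment> \<open>The roots sum to \<open>0\<close>, so \<open>- 2 * x\<close> is the third root next to a double root \<open>x\<close>.\<close>
      have "a * (- 2 * x) ^ 3 + b * (- 2 * x) + c
          = (a * x ^ 3 + b * x + c) + (- 3 * x) * (3 * a * x ^ 2 + b)"
        by (simp add: algebra_simps power2_eq_square power3_eq_cube)
      then have 1: "padic_p dvd a * (- 2 * x) ^ 3 + b * (- 2 * x) + c"
        using x True by (simp only: dvd_add dvd_mult)
      have "\<not> padic_p dvd x"
      proof
        assume "padic_p dvd x"
        then have "padic_p dvd x * (a * x ^ 2 + b)" by simp
        moreover have "a * x ^ 3 + b * x + c = x * (a * x ^ 2 + b) + c"
          by (simp add: algebra_simps power2_eq_square power3_eq_cube)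
        ultimately have "padic_p dvd c" using x by (metis dvd_add_right_iff)
        then show False using c by (simp add: padic_unit_iff)
      qed
      \<comment> \<open>The derivative at \<open>- 2 * x\<close> differs from that at
        \<open>x\<close> by the unit \<open>9 * a * x ^ 2\<close>.\<close>
      then have "\<not> padic_p dvd 3 * (3 * (a * x ^ 2))"
        using a p_not_dvd_3[OF p3] by (simp only: p_dvd_mult_iff p_dvd_power_iff padic_unit_iff) simp
      moreover have "3 * a * (- 2 * x) ^ 2 + b = (3 * a * x ^ 2 + b) + 3 * (3 * (a * x ^ 2))"
        by (simp add: algebra_simps power2_eq_square)
      ultimately have "\<not> padic_p dvd 3 * a * (- 2 * x) ^ 2 + b"
        using True by (simp only: dvd_add_right_iff not_False_eq_True)
      then show ?thesis using padic_hensel_cubic[OF 1] zero by blast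
    qed
  qed
next
  case (2 d)
  \<comment> \<open>With \<open>\<beta> = 1 / d\<close>, putting \<open>t = c * d * u\<close> and
    \<open>s = 1\<close> gives \<open>c\<close> times
    \<open>a * c ^ 2 * d ^ 3 * u ^ 3 + u + 1\<close>, which modulo \<open>p\<close> is
    \<open>u + 1\<close> with the simple root \<open>- 1\<close>.\<close>
  have pd: "padic_p dvd a * c ^ 2 * d ^ 3"
    using 2(1) by (simp add: p_dvd_mult_iff p_dvd_power_iff)
  have root: "padic_p dvd a * c ^ 2 * d ^ 3 * (- 1) ^ 3 + 1 * (- 1) + 1"
    using pd by simp
  have "padic_p dvd 3 * (a * c ^ 2 * d ^ 3) * (- 1) ^ 2" using pd by (simp add: p_dvd_mult_iff)
  moreover have "\<not> padic_p dvd (1 :: 'p padic_int)" using padic_unit_iff[of 1] by simp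
  ultimately have "\<not> padic_p dvd 3 * (a * c ^ 2 * d ^ 3) * (- 1) ^ 2 + 1"
    by (metis dvd_add_right_iff)
  then obtain u where u: "a * c ^ 2 * d ^ 3 * u ^ 3 + 1 * u + 1 = 0"
    using padic_hensel_cubic[OF root] by blast
  define t where "t = to_fract (c * d * u)"
  have "to_fract a * t ^ 3 + \<beta> * t * 1 ^ 2 + to_fract c * 1 ^ 3
      = to_fract c * to_fract (a * c ^ 2 * d ^ 3 * u ^ 3) + \<beta> * to_fract d * to_fract c * to_fract u
        + to_fract c"
    by (simp add: t_def to_fract_power algebra_simps power2_eq_square power3_eq_cube)
  also have "\<dots> = to_fract c * to_fract (a * c ^ 2 * d ^ 3 * u ^ 3 + 1 * u + 1)"
    unfolding 2(2) by (simp add: algebra_simps)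
  finally have "to_fract a * t ^ 3 + \<beta> * t * 1 ^ 2 + to_fract c * 1 ^ 3 = 0"
    unfolding u by simp
  then have ?zero by (intro exI[of _ t] exI[of _ 1]) simp
  then show ?thesis ..
qed

text \<open>If there is no zero, the binary forms got by setting one variable to \<open>0\<close>
  have integral coefficients, and the reduced curve has no point at infinity. Its affine point then
  yields a binary form with a root modulo \<open>p\<close>, hence a zero.\<close>

lemma ternary_cubic_zero:
  fixes a b c :: "'p :: prime_card padic_int" and \<beta> l m :: "'p padic"
  assumes p3: "CARD('p) \<noteq> 3" and a: "a dvd 1" and b: "b dvd 1" and c: "c dvd 1"
  shows "\<exists>t t' s. (t \<noteq> 0 \<or> t' \<noteq> 0 \<or> s \<noteq> 0) \<and>
    to_fract a * t ^ 3 + \<beta> * t * t' ^ 2 + to_fract b * t' ^ 3 + s ^ 2 * (l * t + m * t')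
      + to_fract c * s ^ 3 = 0"
proof (rule ccontr)
  define F where "F t t' s = to_fract a * t ^ 3 + \<beta> * t * t' ^ 2 + to_fract b * t' ^ 3
    + s ^ 2 * (l * t + m * t') + to_fract c * s ^ 3" for t t' s
  assume "\<not> ?thesis"
  then have no_zero: "t = 0 \<and> t' = 0 \<and> s = 0" if "F t t' s = 0" for t t' s
    using that unfolding F_def by blast
  have "F t t' 0 = to_fract a * t ^ 3 + \<beta> * t * t' ^ 2 + to_fract b * t' ^ 3" for t t'
    by (simp add: F_def)
  then obtain \<beta>0 where \<beta>0: "\<beta> = to_fract \<beta>0"
    and no_root: "\<And>x. \<not> padic_p dvd a * x ^ 3 + \<beta>0 * x + b"
    using binary_cubic_zero_or_no_root[OF p3 a b, of \<beta>] no_zero by metis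
  have "F t 0 s = to_fract a * t ^ 3 + l * t * s ^ 2 + to_fract c * s ^ 3" for t s
    by (simp add: F_def)
  then obtain l0 where l0: "l = to_fract l0"
    using binary_cubic_zero_or_no_root[OF p3 a c, of l] no_zero by metis
  have "F 0 t s = to_fract b * t ^ 3 + m * t * s ^ 2 + to_fract c * s ^ 3" for t s
    by (simp add: F_def)
  then obtain m0 where m0: "m = to_fract m0"
    using binary_cubic_zero_or_no_root[OF p3 b c, of m] no_zero by metis
  have "padic_red a \<noteq> 0" "padic_red c \<noteq> 0"
    using a c by (simp_all add: padic_red_eq_0_iff padic_unit_iff)
  moreover have "padic_red a * r ^ 3 + padic_red \<beta>0 * r + padic_red b \<noteq> 0" if r: "r \<in> Fp" for r
  proof -
    from r obtain x where "padic_red x = r" by (rule Fp_padic_red)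
    then show ?thesis
      using no_root[of x]
      by (simp flip: padic_red_eq_0_iff add: padic_red_add padic_red_mult padic_red_power)
  qed
  ultimately obtain x y where "x \<in> Fp" "y \<in> Fp" and xy: "padic_red a * x ^ 3
      + padic_red \<beta>0 * x * y ^ 2 + padic_red b * y ^ 3 + padic_red l0 * x + padic_red m0 * y
      + padic_red c = 0"
    using cubic_curve_has_point[of "padic_red a" "padic_red \<beta>0" "padic_red c" "padic_red b"
        "padic_red l0" "padic_red m0"] padic_red_in_Fp by blast
  then obtain x0 y0 where XY: "padic_red x0 = x" "padic_red y0 = y" by (metis Fp_padic_red)
  \<comment> \<open>On vectors \<open>(t * x0, t * y0, s)\<close> the form is binary with
    coefficients \<open>A\<close>, \<open>l0 * x0 + m0 * y0\<close> and \<open>c\<close>.\<close>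
  define A where "A = a * x0 ^ 3 + \<beta>0 * x0 * y0 ^ 2 + b * y0 ^ 3"
  have pA: "padic_p dvd A + (l0 * x0 + m0 * y0) + c"
    using xy unfolding XY[symmetric] A_def
    by (simp flip: padic_red_eq_0_iff add: padic_red_add padic_red_mult padic_red_power add_ac)
  have XY_unit: "\<not> (padic_p dvd x0 \<and> padic_p dvd y0)"
  proof
    assume "padic_p dvd x0 \<and> padic_p dvd y0"
    then have "padic_p dvd A + (l0 * x0 + m0 * y0)"
      by (simp add: A_def p_dvd_mult_iff p_dvd_power_iff)
    then have "padic_p dvd c" using pA by (simp add: dvd_add_right_iff)
    then show False using c by (simp add: padic_unit_iff)
  qed
  \<comment> \<open>Otherwise \<open>p\<close> divides both coordinates, or \<open>x0 / y0\<close>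
    is a root modulo \<open>p\<close> of a cubic that has none.\<close>
  have "\<not> padic_p dvd A"
  proof
    assume A: "padic_p dvd A"
    show False
    proof (cases "padic_p dvd y0")
      case True
      then have "padic_p dvd \<beta>0 * x0 * y0 ^ 2 + b * y0 ^ 3"
        by (simp add: p_dvd_mult_iff p_dvd_power_iff)
      then have "padic_p dvd a * x0 ^ 3"
        using A unfolding A_def by (metis add.assoc dvd_add_left_iff)
      then have "padic_p dvd x0" using a by (simp add: padic_unit_iff p_dvd_mult_iff p_dvd_power_iff)
      with True XY_unit show False by blast
    next
      case False
      then have "y0 dvd 1" by (simp add: padic_unit_iff)
      then obtain z0 where z0: "y0 * z0 = 1" by (auto simp: dvd_def)
      have "a * (x0 * z0) ^ 3 + \<beta>0 * (x0 * z0) + b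
          = z0 ^ 3 * (a * x0 ^ 3) + \<beta>0 * x0 * z0 * (y0 * z0) ^ 2 + b * (y0 * z0) ^ 3"
        unfolding z0 by (simp add: algebra_simps)
      also have "\<dots> = z0 ^ 3 * A"
        by (simp add: A_def algebra_simps power2_eq_square power3_eq_cube)
      finally show False using A no_root[of "x0 * z0"] by simp
    qed
  qed
  then have "A dvd 1" by (simp add: padic_unit_iff)
  from binary_cubic_zero_or_no_root[OF p3 this c, of "to_fract (l0 * x0 + m0 * y0)"]
  consider t s where "t \<noteq> 0 \<or> s \<noteq> 0"
      "to_fract A * t ^ 3 + to_fract (l0 * x0 + m0 * y0) * t * s ^ 2 + to_fract c * s ^ 3 = 0"
    | e where "to_fract (l0 * x0 + m0 * y0) = to_fract e" "\<And>x. \<not> padic_p dvd A * x ^ 3 + e * x + c"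
    by blast
  then show False
  proof cases
    case 1
    have "F (t * to_fract x0) (t * to_fract y0) s
        = to_fract A * t ^ 3 + to_fract (l0 * x0 + m0 * y0) * t * s ^ 2 + to_fract c * s ^ 3"
      by (simp add: F_def A_def \<beta>0 l0 m0 to_fract_power algebra_simps power2_eq_square power3_eq_cube)
    then have "t * to_fract x0 = 0" "t * to_fract y0 = 0" "s = 0" using no_zero 1(2) by metis+
    then have "x0 = 0" "y0 = 0" using 1(1) by auto
    then show False using XY_unit by simp
  next
    case 2
    then have "e = l0 * x0 + m0 * y0" by (simp only: to_fract_eq_iff)
    \<comment> \<open>The point on the curve says that \<open>1\<close> is a root modulo
      \<open>p\<close>.\<close>
    then show False using pA 2(2)[of 1] by simp
  qed
qed

section \<open>Polarisation\<close>

definition trilin ::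
  "nat \<Rightarrow> (nat \<Rightarrow> nat \<Rightarrow> nat \<Rightarrow> 'k) \<Rightarrow> (nat \<Rightarrow> 'k) \<Rightarrow> (nat \<Rightarrow> 'k) \<Rightarrow> (nat \<Rightarrow> 'k) \<Rightarrow> 'k :: comm_ring_1" where
  "trilin n c x y z = (\<Sum>i<n. \<Sum>j<n. \<Sum>k<n. c i j k * x i * y j * z k)"

text \<open>The coefficient of \<open>t ^ 2 * u\<close> in the cubic form at
  \<open>t x + u z\<close>. Summing over the positions of \<open>z\<close> needs neither a symmetric
  array nor denominators.\<close>

definition polar21 ::
  "nat \<Rightarrow> (nat \<Rightarrow> nat \<Rightarrow> nat \<Rightarrow> 'k) \<Rightarrow> (nat \<Rightarrow> 'k) \<Rightarrow> (nat \<Rightarrow> 'k) \<Rightarrow> 'k :: comm_ring_1" where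
  "polar21 n c x z = trilin n c x x z + trilin n c x z x + trilin n c z x x"

definition polar111 ::
  "nat \<Rightarrow> (nat \<Rightarrow> nat \<Rightarrow> nat \<Rightarrow> 'k) \<Rightarrow> (nat \<Rightarrow> 'k) \<Rightarrow> (nat \<Rightarrow> 'k) \<Rightarrow> (nat \<Rightarrow> 'k) \<Rightarrow> 'k :: comm_ring_1" where
  "polar111 n c x y z = trilin n c x y z + trilin n c x z y + trilin n c y x z
    + trilin n c y z x + trilin n c z x y + trilin n c z y x"

definition bilin :: "nat \<Rightarrow> (nat \<Rightarrow> nat \<Rightarrow> 'k) \<Rightarrow> (nat \<Rightarrow> 'k) \<Rightarrow> (nat \<Rightarrow> 'k) \<Rightarrow> 'k :: comm_ring_1" where
  "bilin n c x y = (\<Sum>i<n. \<Sum>j<n. c i j * x i * y j)"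

definition polar11 :: "nat \<Rightarrow> (nat \<Rightarrow> nat \<Rightarrow> 'k) \<Rightarrow> (nat \<Rightarrow> 'k) \<Rightarrow> (nat \<Rightarrow> 'k) \<Rightarrow> 'k :: comm_ring_1" where
  "polar11 n c x y = bilin n c x y + bilin n c y x"

lemma trilin_add:
  "trilin n c (\<lambda>i. x i + x' i) y z = trilin n c x y z + trilin n c x' y z"
  "trilin n c x (\<lambda>i. y i + y' i) z = trilin n c x y z + trilin n c x y' z"
  "trilin n c x y (\<lambda>i. z i + z' i) = trilin n c x y z + trilin n c x y z'"
  by (simp_all add: trilin_def distrib_left distrib_right sum.distrib)

lemma trilin_scale:
  "trilin n c (\<lambda>i. s * x i) y z = s * trilin n c x y z"
  "trilin n c x (\<lambda>i. s * y i) z = s * trilin n c x y z"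
  "trilin n c x y (\<lambda>i. s * z i) = s * trilin n c x y z"
  by (simp_all add: trilin_def sum_distrib_left mult_ac)

lemma bilin_add:
  "bilin n c (\<lambda>i. x i + x' i) y = bilin n c x y + bilin n c x' y"
  "bilin n c x (\<lambda>i. y i + y' i) = bilin n c x y + bilin n c x y'"
  by (simp_all add: bilin_def distrib_left distrib_right sum.distrib)

lemma bilin_scale:
  "bilin n c (\<lambda>i. s * x i) y = s * bilin n c x y"
  "bilin n c x (\<lambda>i. s * y i) = s * bilin n c x y"
  by (simp_all add: bilin_def sum_distrib_left mult_ac)

lemma cubic_form_trilin: "cubic_form n c x = trilin n c x x x"
  by (simp add: cubic_form_def trilin_def)

lemma quadratic_form_bilin: "quadratic_form n c x = bilin n c x x"
  by (simp add: quadratic_form_def bilin_def)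

lemma forms_0 [simp]:
  "cubic_form n C (\<lambda>_. 0) = 0" "quadratic_form n Q (\<lambda>_. 0) = 0" "linear_form n L (\<lambda>_. 0) = 0"
  "polar21 n C (\<lambda>_. 0) z = 0" "polar21 n C z (\<lambda>_. 0) = 0"
  "polar11 n Q (\<lambda>_. 0) y = 0" "polar11 n Q y (\<lambda>_. 0) = 0"
  by (simp_all add: cubic_form_def quadratic_form_def linear_form_def polar21_def polar11_def
      trilin_def bilin_def)

lemma forms_scale:
  "cubic_form n C (\<lambda>i. s * x i) = s ^ 3 * cubic_form n C x"
  "quadratic_form n Q (\<lambda>i. s * x i) = s ^ 2 * quadratic_form n Q x"
  "linear_form n L (\<lambda>i. s * x i) = s * linear_form n L x"
  "polar21 n C (\<lambda>i. s * x i) z = s ^ 2 * polar21 n C x z"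
  "polar21 n C x (\<lambda>i. s * z i) = s * polar21 n C x z"
  "polar111 n C x y (\<lambda>i. s * z i) = s * polar111 n C x y z"
  "polar11 n Q x (\<lambda>i. s * z i) = s * polar11 n Q x z"
  by (simp_all add: cubic_form_trilin quadratic_form_bilin polar21_def polar111_def polar11_def
      trilin_scale bilin_scale linear_form_def sum_distrib_left algebra_simps power2_eq_square
      power3_eq_cube)

lemma cubic_form_combination:
  "cubic_form n C (\<lambda>i. t * x i + u * y i + s * z i)
    = t ^ 3 * cubic_form n C x + u ^ 3 * cubic_form n C y + s ^ 3 * cubic_form n C z
      + t ^ 2 * u * polar21 n C x y + t * u ^ 2 * polar21 n C y x
      + t ^ 2 * s * polar21 n C x z + t * s ^ 2 * polar21 n C z x
      + u ^ 2 * s * polar21 n C y z + u * s ^ 2 * polar21 n C z y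
      + t * u * s * polar111 n C x y z"
  by (simp add: cubic_form_trilin polar21_def polar111_def trilin_add trilin_scale algebra_simps
      power2_eq_square power3_eq_cube)

lemma quadratic_form_combination:
  "quadratic_form n Q (\<lambda>i. t * x i + u * y i + s * z i)
    = t ^ 2 * quadratic_form n Q x + u ^ 2 * quadratic_form n Q y + s ^ 2 * quadratic_form n Q z
      + t * u * polar11 n Q x y + t * s * polar11 n Q x z + u * s * polar11 n Q y z"
  by (simp add: quadratic_form_bilin polar11_def bilin_add bilin_scale algebra_simps
      power2_eq_square)

lemma linear_form_combination:
  "linear_form n L (\<lambda>i. t * x i + u * y i + s * z i)
    = t * linear_form n L x + u * linear_form n L y + s * linear_form n L z"
  by (simp add: linear_form_def sum_distrib_left sum.distrib algebra_simps)

lemma polar21_combination: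
  "polar21 n C (\<lambda>i. t * x i + u * y i) z
    = t ^ 2 * polar21 n C x z + t * u * polar111 n C x y z + u ^ 2 * polar21 n C y z"
  by (simp add: polar21_def polar111_def trilin_add trilin_scale algebra_simps power2_eq_square)

lemma polar21_cong:
  assumes "\<And>i. i < n \<Longrightarrow> x i = x' i"
  shows "polar21 n C x z = polar21 n C x' z"
  by (simp add: polar21_def trilin_def assms)

lemma polar21_self: "polar21 n C x x = 3 * cubic_form n C x"
  by (simp add: polar21_def cubic_form_trilin)

text \<open>Solvability speaks of coefficient arrays; these predicates let the polar conditions
  count as forms without writing their arrays down.\<close>

definition is_linear :: "nat \<Rightarrow> ((nat \<Rightarrow> 'k) \<Rightarrow> 'k :: comm_ring_1) \<Rightarrow> bool" where
  "is_linear n \<phi> \<longleftrightarrow> (\<exists>a. \<forall>x. \<phi> x = linear_form n a x)"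

definition is_quadratic :: "nat \<Rightarrow> ((nat \<Rightarrow> 'k) \<Rightarrow> 'k :: comm_ring_1) \<Rightarrow> bool" where
  "is_quadratic n \<phi> \<longleftrightarrow> (\<exists>a. \<forall>x. \<phi> x = quadratic_form n a x)"

lemma is_linear_form: "is_linear n (linear_form n a)"
  by (auto simp: is_linear_def)

lemma is_quadratic_form: "is_quadratic n (quadratic_form n a)"
  by (auto simp: is_quadratic_def)

lemma is_linear_coord:
  assumes "i < n"
  shows "is_linear n (\<lambda>x. x i)"
  unfolding is_linear_def linear_form_def
  by (rule exI[of _ "\<lambda>j. if j = i then 1 else 0"])
    (use assms in \<open>simp add: if_distrib[of "\<lambda>a. a * _"] cong: if_cong\<close>)

lemma is_linear_cmult:
  assumes "is_linear n \<phi>"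
  shows "is_linear n (\<lambda>x. c * \<phi> x)"
proof -
  obtain a where "\<And>x. \<phi> x = linear_form n a x" using assms by (auto simp: is_linear_def)
  then have "\<forall>x. c * \<phi> x = linear_form n (\<lambda>i. c * a i) x"
    by (simp add: linear_form_def sum_distrib_left mult_ac)
  then show ?thesis unfolding is_linear_def by blast
qed

lemma is_linear_multc: "is_linear n \<phi> \<Longrightarrow> is_linear n (\<lambda>x. \<phi> x * c)"
  using is_linear_cmult[of n \<phi> c] by (simp add: mult.commute)

lemma is_linear_add:
  assumes "is_linear n \<phi>" "is_linear n \<psi>"
  shows "is_linear n (\<lambda>x. \<phi> x + \<psi> x)"
proof -
  obtain a b where "\<And>x. \<phi> x = linear_form n a x" "\<And>x. \<psi> x = linear_form n b x"
    using assms by (auto simp: is_linear_def)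
  then have "\<forall>x. \<phi> x + \<psi> x = linear_form n (\<lambda>i. a i + b i) x"
    by (simp add: linear_form_def distrib_right sum.distrib)
  then show ?thesis unfolding is_linear_def by blast
qed

lemma is_linear_sum:
  fixes m :: nat
  assumes "\<And>i. i < m \<Longrightarrow> is_linear n (\<phi> i)"
  shows "is_linear n (\<lambda>x. \<Sum>i<m. \<phi> i x)"
  using assms
proof (induction m)
  case 0
  have "is_linear n (\<lambda>_. 0)" by (auto simp: is_linear_def linear_form_def intro!: exI[of _ "\<lambda>_. 0"])
  then show ?case by simp
next
  case (Suc m)
  then show ?case by (simp add: is_linear_add)
qed

lemma is_quadratic_mult:
  assumes "is_linear n \<phi>" "is_linear n \<psi>"
  shows "is_quadratic n (\<lambda>x. \<phi> x * \<psi> x)"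
proof -
  obtain a b where "\<And>x. \<phi> x = linear_form n a x" "\<And>x. \<psi> x = linear_form n b x"
    using assms by (auto simp: is_linear_def)
  then have "\<forall>x. \<phi> x * \<psi> x = quadratic_form n (\<lambda>i j. a i * b j) x"
    by (simp add: linear_form_def quadratic_form_def sum_product mult_ac)
  then show ?thesis unfolding is_quadratic_def by blast
qed

lemma is_quadratic_multc:
  assumes "is_quadratic n \<phi>"
  shows "is_quadratic n (\<lambda>x. \<phi> x * c)"
proof -
  obtain a where "\<And>x. \<phi> x = quadratic_form n a x" using assms by (auto simp: is_quadratic_def)
  then have "\<forall>x. \<phi> x * c = quadratic_form n (\<lambda>i j. a i j * c) x"
    by (simp add: quadratic_form_def sum_distrib_left mult_ac)
  then show ?thesis unfolding is_quadratic_def by blast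
qed

lemma is_quadratic_add:
  assumes "is_quadratic n \<phi>" "is_quadratic n \<psi>"
  shows "is_quadratic n (\<lambda>x. \<phi> x + \<psi> x)"
proof -
  obtain a b where "\<And>x. \<phi> x = quadratic_form n a x" "\<And>x. \<psi> x = quadratic_form n b x"
    using assms by (auto simp: is_quadratic_def)
  then have "\<forall>x. \<phi> x + \<psi> x = quadratic_form n (\<lambda>i j. a i j + b i j) x"
    by (simp add: quadratic_form_def distrib_right sum.distrib)
  then show ?thesis unfolding is_quadratic_def by blast
qed

lemma is_quadratic_sum:
  fixes m :: nat
  assumes "\<And>i. i < m \<Longrightarrow> is_quadratic n (\<phi> i)"
  shows "is_quadratic n (\<lambda>x. \<Sum>i<m. \<phi> i x)"
  using assms
proof (induction m)
  case 0
  have "is_quadratic n (\<lambda>_. 0)"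
    by (auto simp: is_quadratic_def quadratic_form_def intro!: exI[of _ "\<lambda>_ _. 0"])
  then show ?case by simp
next
  case (Suc m)
  then show ?case by (simp add: is_quadratic_add)
qed

lemma is_linear_trilin:
  "is_linear n (\<lambda>x. trilin n c x y z)" "is_linear n (\<lambda>x. trilin n c y x z)"
  "is_linear n (\<lambda>x. trilin n c y z x)"
  unfolding trilin_def
  by (intro is_linear_sum is_linear_multc is_linear_cmult is_linear_coord; assumption)+

lemma is_quadratic_trilin:
  "is_quadratic n (\<lambda>x. trilin n c x x z)" "is_quadratic n (\<lambda>x. trilin n c x z x)"
  "is_quadratic n (\<lambda>x. trilin n c z x x)"
  unfolding trilin_def
  by (intro is_quadratic_sum is_quadratic_multc is_quadratic_mult is_linear_cmult is_linear_coord;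
      assumption)
    (intro is_quadratic_sum is_quadratic_mult is_linear_multc is_linear_cmult is_linear_coord;
      assumption)+

lemma is_linear_bilin:
  "is_linear n (\<lambda>x. bilin n c x y)" "is_linear n (\<lambda>x. bilin n c y x)"
  unfolding bilin_def
  by (intro is_linear_sum is_linear_multc is_linear_cmult is_linear_coord; assumption)+

lemma is_linear_polar:
  "is_linear n (polar21 n C x)" "is_linear n (polar111 n C x y)" "is_linear n (polar11 n Q x)"
  unfolding polar21_def[abs_def] polar111_def[abs_def] polar11_def[abs_def]
  by (intro is_linear_add is_linear_trilin is_linear_bilin)+

lemma is_quadratic_polar21: "is_quadratic n (\<lambda>x. polar21 n C x z)"
  unfolding polar21_def by (intro is_quadratic_add is_quadratic_trilin)

section \<open>Elimination of a cubic form\<close>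

text \<open>All conditions are packed into one system. The first cubic form enters only through
  linear ones; each cubic form has nine of these, for six slots and three pairs of slots.\<close>

lemma next_vector:
  fixes e :: "nat \<Rightarrow> nat \<Rightarrow> 'k :: field"
  assumes "all_systems_solvable TYPE('k) r (r2 + 6 * r) (r1 + 6 * r2 + 9 * Suc r) n"
  shows "\<exists>f. (\<exists>i<n. f i \<noteq> 0) \<and>
    (\<forall>l<r. cubic_form n (C (Suc l)) f = 0) \<and>
    (\<forall>l<r2. quadratic_form n (Q l) f = 0) \<and>
    (\<forall>l<r1. linear_form n (L l) f = 0) \<and>
    (\<forall>l<r. \<forall>j<6. polar21 n (C (Suc l)) f (e j) = 0) \<and>
    (\<forall>l<r2. \<forall>j<6. polar11 n (Q l) (e j) f = 0) \<and>
    (\<forall>l<Suc r. \<forall>j<6. polar21 n (C l) (e j) f = 0) \<and>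
    (\<forall>l<Suc r. \<forall>i<3. polar111 n (C l) (e i) (e (i + 3)) f = 0)"
proof -
  define \<Phi> where "\<Phi> l = (if l < r2 then quadratic_form n (Q l)
    else (\<lambda>f. polar21 n (C (Suc ((l - r2) div 6))) f (e ((l - r2) mod 6))))" for l
  \<comment> \<open>In the last block the index is \<open>9 * l + k\<close>: \<open>k < 6\<close> is
    a slot, and \<open>k = 6 + i\<close> stands for the pair of slots \<open>i\<close> and
    \<open>i + 3\<close>.\<close>
  define \<Psi> where "\<Psi> l = (if l < r1 then linear_form n (L l)
    else if l < r1 + 6 * r2 then polar11 n (Q ((l - r1) div 6)) (e ((l - r1) mod 6))
    else (let m = l - r1 - 6 * r2; k = m mod 9 in
      if k < 6 then polar21 n (C (m div 9)) (e k)
      else polar111 n (C (m div 9)) (e (k - 6)) (e (k - 6 + 3))))" for l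
  have "is_quadratic n (\<Phi> l)" for l
    by (simp add: \<Phi>_def is_quadratic_form is_quadratic_polar21)
  then have "\<forall>l. \<exists>a. \<forall>x. \<Phi> l x = quadratic_form n a x" unfolding is_quadratic_def by blast
  from choice[OF this] obtain Q' where Q': "\<And>l x. \<Phi> l x = quadratic_form n (Q' l) x" by blast
  have "is_linear n (\<Psi> l)" for l
    by (simp add: \<Psi>_def is_linear_form is_linear_polar Let_def)
  then have "\<forall>l. \<exists>a. \<forall>x. \<Psi> l x = linear_form n a x" unfolding is_linear_def by blast
  from choice[OF this] obtain L' where L': "\<And>l x. \<Psi> l x = linear_form n (L' l) x" by blast
  from assms[unfolded all_systems_solvable_def, rule_format, of "\<lambda>l. C (Suc l)" Q' L']
  obtain f where f: "\<exists>i<n. f i \<noteq> 0" "\<And>l. l < r \<Longrightarrow> cubic_form n (C (Suc l)) f = 0"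
    and quad: "\<And>l. l < r2 + 6 * r \<Longrightarrow> \<Phi> l f = 0"
    and lin: "\<And>l. l < r1 + 6 * r2 + 9 * Suc r \<Longrightarrow> \<Psi> l f = 0"
    unfolding Q' L' by blast
  show ?thesis
  proof (intro exI[of _ f] conjI allI impI)
    show "\<exists>i<n. f i \<noteq> 0" by (fact f(1))
  next
    fix l assume "l < r"
    then show "cubic_form n (C (Suc l)) f = 0" by (rule f(2))
  next
    fix l assume "l < r2"
    then show "quadratic_form n (Q l) f = 0" using quad[of l] by (simp add: \<Phi>_def)
  next
    fix l assume "l < r1"
    then show "linear_form n (L l) f = 0" using lin[of l] by (simp add: \<Psi>_def)
  next
    fix l j :: nat assume "l < r" "j < 6"
    then show "polar21 n (C (Suc l)) f (e j) = 0"
      using quad[of "r2 + (6 * l + j)"] by (simp add: \<Phi>_def)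
  next
    fix l j :: nat assume "l < r2" "j < 6"
    then show "polar11 n (Q l) (e j) f = 0"
      using lin[of "r1 + (6 * l + j)"] by (simp add: \<Psi>_def)
  next
    fix l j :: nat assume "l < Suc r" "j < 6"
    then show "polar21 n (C l) (e j) f = 0"
      using lin[of "r1 + 6 * r2 + (9 * l + j)"] by (simp add: \<Psi>_def Let_def)
  next
    fix l i :: nat assume "l < Suc r" "i < 3"
    then show "polar111 n (C l) (e i) (e (i + 3)) f = 0"
      using lin[of "r1 + 6 * r2 + (9 * l + (6 + i))"] by (simp add: \<Psi>_def Let_def)
  qed
qed

text \<open>If \<open>t x + u y = - s z\<close>, then \<open>polar21\<close> paired with
  \<open>z\<close> is \<open>0\<close> on the left and \<open>3 * s ^ 2\<close> times the value at
  \<open>z\<close> on the right, so \<open>s = 0\<close>. The same argument with \<open>y\<close>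
  and then \<open>x\<close> gives \<open>u = 0\<close> and \<open>t = 0\<close>.\<close>

lemma combination_nonzero:
  fixes x y z :: "nat \<Rightarrow> 'k :: field"
  assumes three: "(3 :: 'k) \<noteq> 0"
    and C: "cubic_form n C x \<noteq> 0" "cubic_form n C y \<noteq> 0" "cubic_form n C z \<noteq> 0"
    and "polar21 n C x y = 0" "polar21 n C x z = 0" "polar111 n C x y z = 0" "polar21 n C y z = 0"
    and tus: "t \<noteq> 0 \<or> u \<noteq> 0 \<or> s \<noteq> 0"
  shows "\<exists>i<n. t * x i + u * y i + s * z i \<noteq> 0"
proof (rule ccontr)
  assume "\<not> ?thesis"
  then have dep: "t * x i + u * y i + s * z i = 0" if "i < n" for i using that by blast
  have "polar21 n C (\<lambda>i. t * x i + u * y i) z = polar21 n C (\<lambda>i. - s * z i) z"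
    by (rule polar21_cong) (use dep in \<open>simp add: eq_neg_iff_add_eq_0\<close>)
  moreover have "\<dots> = (- s) ^ 2 * (3 * cubic_form n C z)"
    by (simp only: forms_scale polar21_self)
  ultimately have s: "s = 0" using assms by (simp add: polar21_combination)
  have "polar21 n C (\<lambda>i. t * x i) y = polar21 n C (\<lambda>i. - u * y i) y"
    by (rule polar21_cong) (use dep s in \<open>simp add: eq_neg_iff_add_eq_0\<close>)
  moreover have "\<dots> = (- u) ^ 2 * (3 * cubic_form n C y)"
    by (simp only: forms_scale polar21_self)
  ultimately have u: "u = 0" using assms by (simp add: forms_scale)
  have "polar21 n C (\<lambda>i. t * x i) x = polar21 n C (\<lambda>_. 0) x"
    by (rule polar21_cong) (use dep s u in simp)
  then have "t = 0" using C three by (simp add: forms_scale polar21_self)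
  then show False using s u tus by simp
qed

text \<open>
  \<open>N i c\<close> means that \<open>c\<close> is \<open>p\<^sup>i\<close> times a unit.  In the proof, six slots \<open>e 0, \<dots>, e 5\<close> are filled one
  after the other, the unused ones being \<open>0\<close>; the values of the first cubic form at the vectors in
  slots \<open>i\<close> and \<open>i + 3\<close> are of class \<open>i\<close>.
\<close>

lemma eliminate_cubic_form:
  fixes N :: "nat \<Rightarrow> 'k :: field \<Rightarrow> bool"
  assumes three: "(3 :: 'k) \<noteq> 0"
    and N_0: "\<And>i. \<not> N i 0"
    and N_scale: "\<And>c. c \<noteq> 0 \<Longrightarrow> \<exists>s i. s \<noteq> 0 \<and> i < 3 \<and> N i (s ^ 3 * c)"
    and N_zero: "\<And>i a b c \<beta> l m. N i a \<Longrightarrow> N i b \<Longrightarrow> N i c \<Longrightarrow>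
      \<exists>t u s. (t \<noteq> 0 \<or> u \<noteq> 0 \<or> s \<noteq> 0) \<and>
        a * t ^ 3 + \<beta> * t * u ^ 2 + b * u ^ 3 + s ^ 2 * (l * t + m * u) + c * s ^ 3 = 0"
    and solv: "all_systems_solvable TYPE('k) r (r2 + 6 * r) (r1 + 6 * r2 + 9 * Suc r) n"
  shows "all_systems_solvable TYPE('k) (Suc r) r2 r1 n"
  unfolding all_systems_solvable_def
proof (intro allI, rule ccontr)
  fix C :: "nat \<Rightarrow> nat \<Rightarrow> nat \<Rightarrow> nat \<Rightarrow> 'k" and Q :: "nat \<Rightarrow> nat \<Rightarrow> nat \<Rightarrow> 'k" and L :: "nat \<Rightarrow> nat \<Rightarrow> 'k"
  assume "\<not> (\<exists>x. (\<exists>i<n. x i \<noteq> 0) \<and> (\<forall>l<Suc r. cubic_form n (C l) x = 0) \<and>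
    (\<forall>l<r2. quadratic_form n (Q l) x = 0) \<and> (\<forall>l<r1. linear_form n (L l) x = 0))"
  then have no_zero: "\<not> (\<forall>l<Suc r. cubic_form n (C l) x = 0)"
    if "\<exists>i<n. x i \<noteq> 0" "\<And>l. l < r2 \<Longrightarrow> quadratic_form n (Q l) x = 0"
      "\<And>l. l < r1 \<Longrightarrow> linear_form n (L l) x = 0" for x
    using that by blast
  define valid where "valid i x \<longleftrightarrow> N i (cubic_form n (C 0) x)
    \<and> (\<forall>l<r. cubic_form n (C (Suc l)) x = 0)
    \<and> (\<forall>l<r2. quadratic_form n (Q l) x = 0) \<and> (\<forall>l<r1. linear_form n (L l) x = 0)" for i x
  \<comment> \<open>Not symmetric: for the first cubic form only the term of degree two in the
    earlier vector \<open>x\<close> must vanish.\<close>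
  define compat where "compat x y \<longleftrightarrow> (\<forall>l<Suc r. polar21 n (C l) x y = 0)
    \<and> (\<forall>l<r. polar21 n (C (Suc l)) y x = 0) \<and> (\<forall>l<r2. polar11 n (Q l) x y = 0)" for x y
  have compat_0: "compat x (\<lambda>_. 0)" for x by (simp add: compat_def)
  have no_triple: False
    if valid: "valid i x" "valid i y" "valid i z" and compat: "compat x y" "compat x z" "compat y z"
      and polar: "\<forall>l<Suc r. polar111 n (C l) x y z = 0" for i x y z
  proof -
    from valid have "N i (cubic_form n (C 0) x)" "N i (cubic_form n (C 0) y)"
      "N i (cubic_form n (C 0) z)"
      by (auto simp: valid_def)
    \<comment> \<open>The cross terms of the first cubic form that survive are those in
      \<open>t * u ^ 2\<close>, \<open>t * s ^ 2\<close> and \<open>u * s ^ 2\<close>.\<close>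
    from N_zero[OF this, of "polar21 n (C 0) y x" "polar21 n (C 0) z x" "polar21 n (C 0) z y"]
    obtain t u s where tus: "t \<noteq> 0 \<or> u \<noteq> 0 \<or> s \<noteq> 0" and
      zero: "cubic_form n (C 0) x * t ^ 3 + polar21 n (C 0) y x * t * u ^ 2
        + cubic_form n (C 0) y * u ^ 3 + s ^ 2 * (polar21 n (C 0) z x * t + polar21 n (C 0) z y * u)
        + cubic_form n (C 0) z * s ^ 3 = 0"
      by blast
    let ?w = "\<lambda>i. t * x i + u * y i + s * z i"
    have "\<exists>i<n. ?w i \<noteq> 0"
    proof (rule combination_nonzero[OF three])
      show "cubic_form n (C 0) x \<noteq> 0" "cubic_form n (C 0) y \<noteq> 0" "cubic_form n (C 0) z \<noteq> 0"
        using valid N_0 unfolding valid_def by metis+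
    qed (use compat polar tus in \<open>auto simp: compat_def\<close>)
    moreover have "quadratic_form n (Q l) ?w = 0" if "l < r2" for l
      using that valid compat by (simp add: quadratic_form_combination valid_def compat_def)
    moreover have "linear_form n (L l) ?w = 0" if "l < r1" for l
      using that valid by (simp add: linear_form_combination valid_def)
    moreover have "cubic_form n (C l) ?w = 0" if "l < Suc r" for l
    proof (cases l)
      case 0
      show ?thesis
        using zero compat polar unfolding 0 cubic_form_combination
        by (simp add: compat_def algebra_simps)
    next
      case (Suc l')
      then show ?thesis
        using that valid compat polar by (simp add: cubic_form_combination compat_def valid_def)
    qed
    ultimately show False using no_zero[of ?w] by blast
  qed
  \<comment> \<open>Within a class slot \<open>i\<close> is filled before slot \<open>i + 3\<close>;
    compatibility is automatic while the latter is empty.\<close>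
  define good where "good e \<longleftrightarrow> (\<forall>j<6. e j = (\<lambda>_. 0) \<or> valid (j mod 3) (e j)) \<and>
    (\<forall>i<3. (e i = (\<lambda>_. 0) \<longrightarrow> e (i + 3) = (\<lambda>_. 0)) \<and> compat (e i) (e (i + 3)))"
    for e :: "nat \<Rightarrow> nat \<Rightarrow> 'k"
  have extend: "\<exists>e' j. good e' \<and> j < 6 \<and> e j = (\<lambda>_. 0) \<and> e' j \<noteq> (\<lambda>_. 0) \<and> (\<forall>k. k \<noteq> j \<longrightarrow> e' k = e k)"
    if e: "good e" for e
  proof -
    obtain f where f: "\<exists>i<n. f i \<noteq> 0"
      "\<forall>l<r. cubic_form n (C (Suc l)) f = 0"
      "\<forall>l<r2. quadratic_form n (Q l) f = 0"
      "\<forall>l<r1. linear_form n (L l) f = 0"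
      "\<forall>l<r. \<forall>j<6. polar21 n (C (Suc l)) f (e j) = 0"
      "\<forall>l<r2. \<forall>j<6. polar11 n (Q l) (e j) f = 0"
      "\<forall>l<Suc r. \<forall>j<6. polar21 n (C l) (e j) f = 0"
      "\<forall>l<Suc r. \<forall>i<3. polar111 n (C l) (e i) (e (i + 3)) f = 0"
      using next_vector[OF solv, of C Q L e]
      by (elim exE conjE) (rule that, (intro exI conjI; assumption), assumption+)
    \<comment> \<open>All other forms vanish at \<open>f\<close>, so a zero here would solve the
      whole system.\<close>
    have "cubic_form n (C 0) f \<noteq> 0"
      using no_zero[OF f(1)] f(2-4) by (auto simp: less_Suc_eq_0_disj)
    then obtain s i where s: "s \<noteq> 0" "i < 3" "N i (s ^ 3 * cubic_form n (C 0) f)"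
      using N_scale by blast
    define g where "g k = s * f k" for k
    have g: "valid i g" using f s(3) by (simp add: valid_def g_def[abs_def] forms_scale)
    have compat: "compat (e j) g" if "j < 6" for j
      using f that by (simp add: compat_def g_def[abs_def] forms_scale)
    have polar: "\<forall>l<Suc r. polar111 n (C l) (e i) (e (i + 3)) g = 0"
      using f(8) s(2) by (simp add: g_def[abs_def] forms_scale)
    have g0: "g \<noteq> (\<lambda>_. 0)" using f(1) s(1) by (auto simp: g_def[abs_def] fun_eq_iff)
    consider "e i = (\<lambda>_. 0)" | "e i \<noteq> (\<lambda>_. 0)" "e (i + 3) = (\<lambda>_. 0)"
      | "e i \<noteq> (\<lambda>_. 0)" "e (i + 3) \<noteq> (\<lambda>_. 0)" by blast
    then show ?thesis
    proof cases
      case 1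
      then have "e (i + 3) = (\<lambda>_. 0)" using e s(2) by (simp add: good_def)
      then have "good (e(i := g))"
        using e s(2) g compat_0 by (auto simp: good_def)
      then show ?thesis using 1 g0 s(2) by (intro exI[of _ "e(i := g)"] exI[of _ i]) auto
    next
      case 2
      then have "good (e(i + 3 := g))"
        using e s(2) g compat[of i] by (auto simp: good_def)
      then show ?thesis using 2 g0 s(2) by (intro exI[of _ "e(i + 3 := g)"] exI[of _ "i + 3"]) auto
    next
      case 3
      \<comment> \<open>Both slots of the class are taken, so \<open>g\<close> completes a forbidden
        triple.\<close>
      have "i < 6" using s(2) by simp
      then have "e i = (\<lambda>_. 0) \<or> valid (i mod 3) (e i)"
        using e unfolding good_def by blast
      then have "valid i (e i)" using 3 s(2) by simp
      moreover have "i + 3 < 6" using s(2) by simp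
      then have "e (i + 3) = (\<lambda>_. 0) \<or> valid ((i + 3) mod 3) (e (i + 3))"
        using e unfolding good_def by blast
      then have "valid i (e (i + 3))" using 3 s(2) by simp
      moreover have "compat (e i) (e (i + 3))" using e s(2) by (simp add: good_def)
      ultimately have False using no_triple g compat[of i] compat[of "i + 3"] polar s(2) by simp
      then show ?thesis ..
    qed
  qed
  \<comment> \<open>Slots could be filled for ever, which is absurd at \<open>k = 7\<close>.\<close>
  have "\<exists>e. good e \<and> k \<le> card {j. j < 6 \<and> e j \<noteq> (\<lambda>_. 0)}" for k
  proof (induction k)
    case 0
    have "good (\<lambda>_ _. 0)" by (simp add: good_def compat_0)
    then show ?case by blast
  next
    case (Suc k)
    then obtain e where e: "good e" "k \<le> card {j. j < 6 \<and> e j \<noteq> (\<lambda>_. 0)}" by blast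
    from extend[OF e(1)] obtain e' j where e': "good e'" "j < 6" "e j = (\<lambda>_. 0)"
      "e' j \<noteq> (\<lambda>_. 0)" "\<forall>k. k \<noteq> j \<longrightarrow> e' k = e k" by blast
    have "{j. j < 6 \<and> e' j \<noteq> (\<lambda>_. 0)} = insert j {j. j < 6 \<and> e j \<noteq> (\<lambda>_. 0)}"
      using e' by auto
    then have "card {j. j < 6 \<and> e' j \<noteq> (\<lambda>_. 0)} = Suc (card {j. j < 6 \<and> e j \<noteq> (\<lambda>_. 0)})"
      using e'(3) by simp
    then show ?case using e(2) e'(1) by (intro exI[of _ e']) simp
  qed
  then obtain e :: "nat \<Rightarrow> nat \<Rightarrow> 'k" where "7 \<le> card {j. j < 6 \<and> e j \<noteq> (\<lambda>_. 0)}" by blast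
  moreover have "card {j. j < 6 \<and> e j \<noteq> (\<lambda>_. 0)} \<le> card {..<6 :: nat}"
    by (rule card_mono) auto
  ultimately show False by simp
qed

section \<open>Classes of the valuation modulo 3\<close>

definition p_class :: "nat \<Rightarrow> 'p :: prime_card padic \<Rightarrow> bool" where
  "p_class i c \<longleftrightarrow> (\<exists>u. u dvd 1 \<and> c = to_fract (padic_p ^ i * u))"

lemma p_class_0: "\<not> p_class i 0"
proof
  assume "p_class i (0 :: 'a padic)"
  then obtain u :: "'a padic_int" where "u dvd 1" "to_fract (padic_p ^ i * u) = 0"
    unfolding p_class_def by metis
  then have "u dvd 1" "u = 0" by (simp_all del: to_fract_mult)
  then show False by simp
qed

lemma p_class_scale:
  fixes c :: "'p :: prime_card padic"
  assumes "c \<noteq> 0"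
  shows "\<exists>s i. s \<noteq> 0 \<and> i < 3 \<and> p_class i (s ^ 3 * c)"
proof (cases c)
  case (Fract x y)
  have "x \<noteq> 0" using assms Fract by (auto simp: fract_collapse)
  then obtain m u where x: "x = padic_p ^ m * u" "u dvd 1" by (rule padic_unit_decomp)
  from Fract(2) obtain k w where y: "y = padic_p ^ k * w" "w dvd 1" by (rule padic_unit_decomp)
  \<comment> \<open>Multiplying by \<open>y ^ 3\<close> clears the denominator and gives the
    valuation \<open>2 * k + m\<close>; dividing by the cube of \<open>P ^ d\<close> leaves its
    remainder modulo 3.\<close>
  define d where "d = (2 * k + m) div 3"
  define i where "i = (2 * k + m) mod 3"
  define P :: "'p padic" where "P = to_fract padic_p"
  have P: "P \<noteq> 0" by (simp add: P_def)
  have exp: "2 * k + m = 3 * d + i" by (simp add: d_def i_def)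
  define s where "s = to_fract y / P ^ d"
  have w0: "to_fract w \<noteq> 0" using Fract(2) y by auto
  have "s ^ 3 * c = (P ^ k) ^ 2 * P ^ m / (P ^ d) ^ 3 * (to_fract w ^ 2 * to_fract u)"
    using P w0 unfolding s_def Fract(1) Fract_conv_to_fract
    by (simp add: x(1) y(1) to_fract_power P_def field_simps power2_eq_square power3_eq_cube)
  also have "(P ^ k) ^ 2 * P ^ m = P ^ (2 * k + m)"
    by (simp add: power_add mult.commute flip: power_mult)
  also have "\<dots> / (P ^ d) ^ 3 = P ^ i"
    using P unfolding exp by (simp add: power_add mult.commute flip: power_mult)
  finally have "s ^ 3 * c = to_fract (padic_p ^ i * (w ^ 2 * u))"
    by (simp add: P_def to_fract_power)
  moreover have "w ^ 2 * u dvd 1"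
    using x(2) y(2) by (simp add: padic_unit_iff p_dvd_mult_iff p_dvd_power_iff)
  ultimately have "p_class i (s ^ 3 * c)" unfolding p_class_def by blast
  moreover have "s \<noteq> 0" "i < 3" using Fract(2) P by (simp_all add: s_def i_def)
  ultimately show ?thesis by blast
qed

text \<open>Dividing by the common factor \<open>p ^ i\<close> makes the outer coefficients units;
  the other three may be any elements of the field.\<close>

lemma p_class_ternary_zero:
  fixes a b c \<beta> l m :: "'p :: prime_card padic"
  assumes "CARD('p) \<noteq> 3" and "p_class i a" "p_class i b" "p_class i c"
  shows "\<exists>t u s. (t \<noteq> 0 \<or> u \<noteq> 0 \<or> s \<noteq> 0) \<and>
    a * t ^ 3 + \<beta> * t * u ^ 2 + b * u ^ 3 + s ^ 2 * (l * t + m * u) + c * s ^ 3 = 0"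
proof -
  define P :: "'p padic" where "P = to_fract (padic_p ^ i)"
  have P: "P \<noteq> 0" by (simp add: P_def)
  obtain a' b' c' where units: "a' dvd 1" "b' dvd 1" "c' dvd 1"
    and abc: "a = P * to_fract a'" "b = P * to_fract b'" "c = P * to_fract c'"
    using assms(2-4) unfolding p_class_def P_def to_fract_mult by blast
  obtain t u s where nonzero: "t \<noteq> 0 \<or> u \<noteq> 0 \<or> s \<noteq> 0"
    and zero: "to_fract a' * t ^ 3 + \<beta> / P * t * u ^ 2 + to_fract b' * u ^ 3
      + s ^ 2 * (l / P * t + m / P * u) + to_fract c' * s ^ 3 = 0"
    using ternary_cubic_zero[OF assms(1) units, of "\<beta> / P" "l / P" "m / P"] by blast
  have "a * t ^ 3 + \<beta> * t * u ^ 2 + b * u ^ 3 + s ^ 2 * (l * t + m * u) + c * s ^ 3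
      = P * (to_fract a' * t ^ 3 + \<beta> / P * t * u ^ 2 + to_fract b' * u ^ 3
        + s ^ 2 * (l / P * t + m / P * u) + to_fract c' * s ^ 3)"
    using P unfolding abc by (simp add: distrib_left distrib_right mult.left_commute mult.assoc)
  also have "\<dots> = 0" unfolding zero by simp
  finally show ?thesis using nonzero by blast
qed

theorem theorem3:
  fixes r1 r2 r3 :: nat
  assumes "CARD('p :: prime_card) \<noteq> 3" and "r3 > 0"
  shows "V TYPE('p) r3 r2 r1
    \<le> V TYPE('p) (r3 - 1) (r2 + 6 * (r3 - 1)) (r1 + 6 * r2 + 9 * r3)"
proof -
  obtain r where r: "r3 = Suc r" using assms(2) gr0_implies_Suc by blast
  have "(1 + 1 + 1 :: 'p padic_int) \<noteq> 0" using p_not_dvd_3[OF assms(1)] by auto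
  then have "to_fract (1 + 1 + 1 :: 'p padic_int) \<noteq> 0"
    by (simp only: to_fract_eq_0_iff not_False_eq_True)
  then have "(1 + 1 + 1 :: 'p padic) \<noteq> 0"
    by (simp only: to_fract_add to_fract_1 not_False_eq_True)
  then have three: "(3 :: 'p padic) \<noteq> 0" by simp
  have "all_systems_solvable TYPE('p padic) (Suc r) r2 r1 n"
    if "all_systems_solvable TYPE('p padic) r (r2 + 6 * r) (r1 + 6 * r2 + 9 * Suc r) n" for n
    by (rule eliminate_cubic_form[where N = p_class, OF three p_class_0 p_class_scale
          p_class_ternary_zero[OF assms(1)] that])
  \<comment> \<open>The bounds admissible on the right are admissible on the left, and a larger set
    has a smaller infimum.\<close>
  then show ?thesis
    unfolding V_def r diff_Suc_1 by (intro Inf_superset_mono) blast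
qed

end
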